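(* Let $F,G\in\mathcal{M}(m\times m;\mathcal{F})$ with $F$ singular and the pencil $sF-G$ regular, let $B\in\mathcal{M}(m\times r;\mathcal{F})$, $V(t)\in\mathcal{M}(r\times 1;\mathcal{F})$, $Y(t)\in\mathcal{M}(m\times 1;\mathcal{F})$, and consider the system $$FY'(t)=GY(t)+BV(t)$$ with known initial condition $Y(t_0)$. Let $P,Q\in\mathcal{M}(m\times m;\mathcal{F})$ be nonsingular matrices with $PFQ=I_p\oplus H_q$ and $PGQ=J_p\oplus I_q$ (Weierstrass canonical form, $p+q=m$), and let the $p$ linearly independent (generalized) eigenvectors of the finite eigenvalues of the pencil $sF-G$ be the columns of the matrix $Q_p$, where $Q=[\,Q_p\ \ Q_q\,]$. Write $PB=\begin{bmatrix}B_p\\ B_q\end{bmatrix}$ with $B_p\in\mathcal{M}(p\times r;\mathcal{F})$, $B_q\in\mathcal{M}(q\times r;\mathcal{F})$, and set $$K(t)=\begin{bmatrix}\displaystyle\int_{t_0}^{t}e^{J_p(t-s)}B_pV(s)\,ds\\[2mm] \displaystyle-\sum_{i=0}^{q_*-1}H_q^iB_qV^{(i)}(t)\end{bmatrix}.$$ Then the solution is unique (that is, the initial value problem has a unique solution) if and only if $$Y(t_0)\in \operatorname{colspan}Q_p+QK(t_0).$$ Moreover the analytic solution is given by $$Y(t)=Q_pe^{J_p(t-t_0)}Z_p(t_0)+QK(t),$$ where $Z_p(t_0)$ consists of the first $p$ entries of $Z(t_0)=Q^{-1}Y(t_0)$.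
   Context: $\mathcal{M}(n\times m;\mathcal{F})$ denotes the $n\times m$ matrices with elements in the field $\mathcal{F}$. The pencil $sF-G$ of square matrices is regular if $\det(sF-G)$ is not identically zero. $A\oplus B$ denotes the block diagonal matrix with diagonal blocks $A,B$. For a regular pencil there exist nonsingular $P,Q$ bringing it to its (complex) Weierstrass canonical form $PFQ=I_p\oplus H_q$, $PGQ=J_p\oplus I_q$, where $J_p=J_{p_1}(a_1)\oplus\dots\oplus J_{p_\nu}(a_\nu)$ is a direct sum of upper Jordan blocks for the finite eigenvalues $a_j$ of $sF-G$, with $p=\sum_j p_j$, and $H_q=H_{q_1}\oplus\dots\oplus H_{q_\sigma}$ corresponds to the infinite eigenvalues, each $H_{q_j}$ being the $q_j\times q_j$ matrix with ones on the superdiagonal and zeros elsewhere. The number $q_*=\max_j q_j$ is the nilpotency index of $H_q$, so $H_q^{q_*}=0$. The columns of $Q_p$ ($m\times p$) and $Q_q$ ($m\times q$) are the generalized eigenvectors of the finite and infinite eigenvalues respectively. $V^{(i)}$ denotes the $i$-th derivative of $V$. $\operatorname{colspan}Q_p$ is the span of the columns of $Q_p$, and $\operatorname{colspan}Q_p+QK(t_0)$ is its translate by the vector $QK(t_0)$. *)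

theory Defs
  imports
    "HOL-Analysis.Interval_Integral"
    "Jordan_Normal_Form.Jordan_Normal_Form"
    "Jordan_Normal_Form.Gauss_Jordan_Elimination"
    "Jordan_Normal_Form.VS_Connect"
begin

(* Vectors and matrices are those of Jordan_Normal_Form, not the finite Cartesian products of
   HOL-Analysis. *)
unbundle no vec_syntax
hide_const (open) Finite_Cartesian_Product.vec Finite_Cartesian_Product.mat
hide_type (open) Finite_Cartesian_Product.vec

text \<open>
  The scalar type class \<open>{real_normed_field, euclidean_space}\<close> stands for ``the reals or the
  complex numbers'': both are instances, and by the theorems of Gelfand--Mazur and Frobenius
  every instance is isomorphic to one of them. Time is always real.
\<close>

text \<open>
  Type \<^typ>\<open>'a mat\<close> is not a normed algebra, so the library's \<^const>\<open>exp\<close> does not apply;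
  the exponential series is summed entrywise.
\<close>
definition mat_exp :: "'a :: real_normed_field mat \<Rightarrow> 'a mat" where
  "mat_exp A = mat (dim_row A) (dim_col A) (\<lambda>ij. \<Sum>k. (A ^\<^sub>m k) $$ ij /\<^sub>R fact k)"

text \<open>
  Differentiation relative to a set \<open>T\<close> of times, hence one-sided at an endpoint belonging to
  \<open>T\<close>. The length of the vector \<open>f t\<close> is meant to be constant on \<open>T\<close>.
\<close>
definition vec_differentiable_on :: "(real \<Rightarrow> 'a :: real_normed_vector vec) \<Rightarrow> real set \<Rightarrow> bool" where
  "vec_differentiable_on f T \<longleftrightarrow>
     (\<forall>t\<in>T. \<forall>i<dim_vec (f t). (\<lambda>s. f s $ i) differentiable (at t within T))"

definition vec_deriv :: "real set \<Rightarrow> (real \<Rightarrow> 'a :: real_normed_vector vec) \<Rightarrow> real \<Rightarrow> 'a vec" where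
  "vec_deriv T f t = vec (dim_vec (f t)) (\<lambda>i. vector_derivative (\<lambda>s. f s $ i) (at t within T))"

definition vec_derivs :: "real set \<Rightarrow> nat \<Rightarrow> (real \<Rightarrow> 'a :: real_normed_vector vec) \<Rightarrow> real \<Rightarrow> 'a vec" where
  "vec_derivs T k f = (vec_deriv T ^^ k) f"

text \<open>Continuity of the \<open>k\<close>-th derivative is not required.\<close>
definition vec_times_differentiable_on :: "nat \<Rightarrow> (real \<Rightarrow> 'a :: real_normed_vector vec) \<Rightarrow> real set \<Rightarrow> bool" where
  "vec_times_differentiable_on k f T \<longleftrightarrow> (\<forall>i<k. vec_differentiable_on (vec_derivs T i f) T)"

definition vec_interval_integral ::
  "nat \<Rightarrow> real \<Rightarrow> real \<Rightarrow> (real \<Rightarrow> 'a :: euclidean_space vec) \<Rightarrow> 'a vec" where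
  "vec_interval_integral n a b f = vec n (\<lambda>i. LBINT s=ereal a..ereal b. f s $ i)"

definition regular_pencil :: "'a :: field mat \<Rightarrow> 'a mat \<Rightarrow> bool" where
  "regular_pencil F G \<longleftrightarrow> (\<exists>s. det (s \<cdot>\<^sub>m F - G) \<noteq> 0)"

definition block_cols :: "'a :: zero mat \<Rightarrow> 'a mat \<Rightarrow> 'a mat" where
  "block_cols A B = four_block_mat A B (0\<^sub>m 0 (dim_col A)) (0\<^sub>m 0 (dim_col B))"

text \<open>
  \<open>as\<close> lists the pairs \<open>(p\<^sub>j, a\<^sub>j)\<close> of sizes and eigenvalues of the finite Jordan blocks,
  \<open>qs\<close> the sizes \<open>q\<^sub>j\<close> of the nilpotent blocks.
\<close>
definition weierstrass_form ::
  "'a :: field mat \<Rightarrow> 'a mat \<Rightarrow> 'a mat \<Rightarrow> 'a mat \<Rightarrow> (nat \<times> 'a) list \<Rightarrow> nat list \<Rightarrow> bool" where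
  "weierstrass_form F G P Q as qs \<longleftrightarrow>
     invertible_mat P \<and> invertible_mat Q \<and> 0 \<notin> fst ` set as \<and> 0 \<notin> set qs \<and>
     P * F * Q = diag_block_mat [1\<^sub>m (sum_list (map fst as)), jordan_matrix (map (\<lambda>n. (n, 0)) qs)] \<and>
     P * G * Q = diag_block_mat [jordan_matrix as, 1\<^sub>m (sum_list qs)]"

definition dae_solution ::
  "'a :: {real_normed_field, euclidean_space} mat \<Rightarrow> 'a mat \<Rightarrow> 'a mat \<Rightarrow> (real \<Rightarrow> 'a vec) \<Rightarrow>
   real set \<Rightarrow> (real \<Rightarrow> 'a vec) \<Rightarrow> bool" where
  "dae_solution F G B V T Y \<longleftrightarrow>
     (\<forall>t\<in>T. Y t \<in> carrier_vec (dim_col F)) \<and> vec_differentiable_on Y T \<and>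
     (\<forall>t\<in>T. F *\<^sub>v vec_deriv T Y t = G *\<^sub>v Y t + B *\<^sub>v V t)"

definition ivp_solution ::
  "'a :: {real_normed_field, euclidean_space} mat \<Rightarrow> 'a mat \<Rightarrow> 'a mat \<Rightarrow> (real \<Rightarrow> 'a vec) \<Rightarrow>
   real set \<Rightarrow> real \<Rightarrow> 'a vec \<Rightarrow> (real \<Rightarrow> 'a vec) \<Rightarrow> bool" where
  "ivp_solution F G B V T t0 Y0 Y \<longleftrightarrow> dae_solution F G B V T Y \<and> Y t0 = Y0"

text \<open>Solutions are total functions in HOL, so they are identified when they agree on \<open>T\<close>.\<close>
definition ivp_has_unique_solution ::
  "'a :: {real_normed_field, euclidean_space} mat \<Rightarrow> 'a mat \<Rightarrow> 'a mat \<Rightarrow> (real \<Rightarrow> 'a vec) \<Rightarrow>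
   real set \<Rightarrow> real \<Rightarrow> 'a vec \<Rightarrow> bool" where
  "ivp_has_unique_solution F G B V T t0 Y0 \<longleftrightarrow>
     (\<exists>Y. ivp_solution F G B V T t0 Y0 Y \<and>
          (\<forall>X. ivp_solution F G B V T t0 Y0 X \<longrightarrow> (\<forall>t\<in>T. X t = Y t)))"

definition particular_K ::
  "real set \<Rightarrow> real \<Rightarrow> 'a :: {real_normed_field, euclidean_space} mat \<Rightarrow> 'a mat \<Rightarrow> 'a mat \<Rightarrow> 'a mat \<Rightarrow>
   nat \<Rightarrow> (real \<Rightarrow> 'a vec) \<Rightarrow> real \<Rightarrow> 'a vec" where
  "particular_K T t0 Jp Bp Hq Bq qmax V t =
     vec_interval_integral (dim_row Jp) t0 t
       (\<lambda>s. mat_exp (of_real (t - s) \<cdot>\<^sub>m Jp) *\<^sub>v (Bp *\<^sub>v V s))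
     @\<^sub>v vec (dim_row Hq) (\<lambda>j. - (\<Sum>i<qmax. ((Hq ^\<^sub>m i) *\<^sub>v (Bq *\<^sub>v vec_derivs T i V t)) $ j))"

abbreviation column_span :: "'a :: field mat \<Rightarrow> 'a vec set" where
  "column_span A \<equiv> vec_space.col_space (dim_row A) A"

end

theory Submission
  imports Defs
begin

text \<open>
  Substituting \<open>Y = Q Z\<close> and multiplying by \<open>P\<close> decouples the system into the ordinary differential
  equation \<open>Z\<^sub>p' = J\<^sub>p Z\<^sub>p + B\<^sub>p V\<close> and the equation \<open>H\<^sub>q Z\<^sub>q' = Z\<^sub>q + B\<^sub>q V\<close>. The former is solved, uniquely for
  every initial value, by variation of constants. The latter has exactly one solution and leaves no
  freedom for the initial value: a difference \<open>W\<close> of two solutions satisfies \<open>H\<^sub>q W' = W\<close>, and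
  \<open>H\<^sub>q\<^sup>k W = 0\<close> implies \<open>H\<^sub>q\<^sup>k W' = 0\<close>, hence \<open>H\<^sub>q\<^sup>k\<^sup>-\<^sup>1 W = 0\<close>, so that nilpotency gives \<open>W = 0\<close> by descent.
  A solution therefore exists if and only if the last \<open>q\<close> entries of \<open>Q\<^sup>-\<^sup>1 Y(t\<^sub>0)\<close> are those of \<open>K(t\<^sub>0)\<close>.
\<close>

subsection \<open>Entrywise differentiation\<close>

text \<open>The differentiated entries are determined by the length of \<open>d\<close>, not by that of \<open>f\<close>.\<close>
definition has_vec_derivative ::
  "(real \<Rightarrow> 'a :: real_normed_vector vec) \<Rightarrow> 'a vec \<Rightarrow> real filter \<Rightarrow> bool" where
  "has_vec_derivative f d F \<longleftrightarrow> (\<forall>i<dim_vec d. ((\<lambda>s. f s $ i) has_vector_derivative d $ i) F)"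

lemma has_vec_derivative_transform:
  assumes "has_vec_derivative f d (at t within S)" "t \<in> S" "\<And>s. s \<in> S \<Longrightarrow> g s = f s"
  shows "has_vec_derivative g d (at t within S)"
  using assms unfolding has_vec_derivative_def
  by (auto intro: has_vector_derivative_transform[where f = "\<lambda>s. f s $ i" for i])

lemma has_vec_derivative_const: "has_vec_derivative (\<lambda>_. c) (0\<^sub>v n) F"
  unfolding has_vec_derivative_def by auto

text \<open>The length hypothesis falls on \<open>g\<close> because a sum of vectors takes its
  dimension from the right summand; entries of the sum below \<open>n\<close> are then sums of
  entries.\<close>

lemma has_vec_derivative_add:
  assumes "has_vec_derivative f d (at t within S)" "has_vec_derivative g e (at t within S)"
    and "t \<in> S" "\<And>s. s \<in> S \<Longrightarrow> g s \<in> carrier_vec n" "d \<in> carrier_vec n" "e \<in> carrier_vec n"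
  shows "has_vec_derivative (\<lambda>s. f s + g s) (d + e) (at t within S)"
  unfolding has_vec_derivative_def
proof safe
  fix i assume i: "i < dim_vec (d + e)"
  have "((\<lambda>s. f s $ i + g s $ i) has_vector_derivative d $ i + e $ i) (at t within S)"
    using assms i unfolding has_vec_derivative_def by (intro has_vector_derivative_add) auto
  then show "((\<lambda>s. (f s + g s) $ i) has_vector_derivative (d + e) $ i) (at t within S)"
    by (rule has_vector_derivative_eq_rhs[OF has_vector_derivative_transform[rotated 2]])
      (use assms i in \<open>fastforce dest: carrier_vecD\<close>)+
qed

lemma has_vec_derivative_diff:
  assumes "has_vec_derivative f d (at t within S)" "has_vec_derivative g e (at t within S)"
    and "t \<in> S" "\<And>s. s \<in> S \<Longrightarrow> g s \<in> carrier_vec n" "d \<in> carrier_vec n" "e \<in> carrier_vec n"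
  shows "has_vec_derivative (\<lambda>s. f s - g s) (d - e) (at t within S)"
  unfolding has_vec_derivative_def
proof safe
  fix i assume i: "i < dim_vec (d - e)"
  have "((\<lambda>s. f s $ i - g s $ i) has_vector_derivative d $ i - e $ i) (at t within S)"
    using assms i unfolding has_vec_derivative_def by (intro has_vector_derivative_diff) auto
  then show "((\<lambda>s. (f s - g s) $ i) has_vector_derivative (d - e) $ i) (at t within S)"
    by (rule has_vector_derivative_eq_rhs[OF has_vector_derivative_transform[rotated 2]])
      (use assms i in \<open>fastforce dest: carrier_vecD\<close>)+
qed

lemma has_vec_derivative_append:
  assumes "has_vec_derivative f d (at t within S)" "has_vec_derivative g e (at t within S)"
    and "t \<in> S" "\<And>s. s \<in> S \<Longrightarrow> f s \<in> carrier_vec n" "\<And>s. s \<in> S \<Longrightarrow> g s \<in> carrier_vec k"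
    and "d \<in> carrier_vec n" "e \<in> carrier_vec k"
  shows "has_vec_derivative (\<lambda>s. f s @\<^sub>v g s) (d @\<^sub>v e) (at t within S)"
  unfolding has_vec_derivative_def
proof safe
  fix i assume i: "i < dim_vec (d @\<^sub>v e)"
  show "((\<lambda>s. (f s @\<^sub>v g s) $ i) has_vector_derivative (d @\<^sub>v e) $ i) (at t within S)"
  proof (cases "i < n")
    case True
    have "((\<lambda>s. f s $ i) has_vector_derivative (d @\<^sub>v e) $ i) (at t within S)"
      using assms True i unfolding has_vec_derivative_def by auto
    then show ?thesis
    proof (rule has_vector_derivative_transform[rotated 2])
      fix s assume "s \<in> S"
      then show "(f s @\<^sub>v g s) $ i = f s $ i"
        using True assms(4)[of s] by simp
    qed fact
  next
    case False
    have "((\<lambda>s. g s $ (i - n)) has_vector_derivative (d @\<^sub>v e) $ i) (at t within S)"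
      using assms False i unfolding has_vec_derivative_def by auto
    then show ?thesis
    proof (rule has_vector_derivative_transform[rotated 2])
      fix s assume "s \<in> S"
      then show "(f s @\<^sub>v g s) $ i = g s $ (i - n)"
        using False i assms(4,5)[of s] assms(6,7) by simp
    qed fact
  qed
qed

lemma has_vec_derivative_vec_first:
  assumes "has_vec_derivative f d F" "d \<in> carrier_vec (p + q)"
  shows "has_vec_derivative (\<lambda>s. vec_first (f s) p) (vec_first d p) F"
  using assms by (auto simp: has_vec_derivative_def vec_first_def)

text \<open>\<open>vec_last\<close> counts from the end, so its index offset depends on the length
  of \<open>f s\<close>. On \<open>S\<close> this length is \<open>p + q\<close>, and the offset is
  the constant \<open>p\<close>.\<close>

lemma has_vec_derivative_vec_last:
  assumes "has_vec_derivative f d (at t within S)" "d \<in> carrier_vec (p + q)"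
    and "t \<in> S" "\<And>s. s \<in> S \<Longrightarrow> f s \<in> carrier_vec (p + q)"
  shows "has_vec_derivative (\<lambda>s. vec_last (f s) q) (vec_last d q) (at t within S)"
proof (rule has_vec_derivative_transform)
  show "has_vec_derivative (\<lambda>s. vec q (\<lambda>i. f s $ (p + i))) (vec_last d q) (at t within S)"
    using assms by (auto simp: has_vec_derivative_def vec_last_def)
  show "vec_last (f s) q = vec q (\<lambda>i. f s $ (p + i))" if "s \<in> S" for s
    using assms(4)[OF that] by (auto simp: vec_last_def)
qed fact

lemma index_mult_mat_vec_sum:
  "A \<in> carrier_mat n k \<Longrightarrow> x \<in> carrier_vec k \<Longrightarrow> i < n \<Longrightarrow>
   (A *\<^sub>v x) $ i = (\<Sum>j<k. A $$ (i, j) * x $ j)"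
  by (auto simp: scalar_prod_def lessThan_atLeast0)

text \<open>The product rule, reduced to the scalar one: each entry of the product is a finite sum
  of products of scalar functions.\<close>

lemma has_vec_derivative_mult_mat_vec:
  fixes A :: "real \<Rightarrow> 'a :: real_normed_field mat"
  assumes t: "t \<in> S"
    and A: "\<And>s. s \<in> S \<Longrightarrow> A s \<in> carrier_mat n k" "A' \<in> carrier_mat n k"
    and x: "\<And>s. s \<in> S \<Longrightarrow> x s \<in> carrier_vec k" "x' \<in> carrier_vec k"
    and dA: "\<And>i j. i < n \<Longrightarrow> j < k \<Longrightarrow>
      ((\<lambda>s. A s $$ (i, j)) has_vector_derivative A' $$ (i, j)) (at t within S)"
    and dx: "has_vec_derivative x x' (at t within S)"
  shows "has_vec_derivative (\<lambda>s. A s *\<^sub>v x s) (A' *\<^sub>v x t + A t *\<^sub>v x') (at t within S)"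
  unfolding has_vec_derivative_def
proof safe
  fix i assume "i < dim_vec (A' *\<^sub>v x t + A t *\<^sub>v x')"
  then have i: "i < n" using A t by auto
  have "((\<lambda>s. \<Sum>j<k. A s $$ (i, j) * x s $ j) has_vector_derivative
      (\<Sum>j<k. A t $$ (i, j) * x' $ j + A' $$ (i, j) * x t $ j)) (at t within S)"
    using dA dx i x unfolding has_vec_derivative_def
    by (intro has_vector_derivative_sum has_vector_derivative_mult) auto
  moreover have "(\<Sum>j<k. A t $$ (i, j) * x' $ j + A' $$ (i, j) * x t $ j) =
      (A' *\<^sub>v x t + A t *\<^sub>v x') $ i"
    using index_mult_mat_vec_sum[OF A(2) x(1)[OF t] i] index_mult_mat_vec_sum[OF A(1)[OF t] x(2) i] i A(2) A(1)[OF t]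
    by (simp add: sum.distrib del: index_mult_mat_vec)
  ultimately show "((\<lambda>s. (A s *\<^sub>v x s) $ i) has_vector_derivative
      (A' *\<^sub>v x t + A t *\<^sub>v x') $ i) (at t within S)"
    using index_mult_mat_vec_sum[OF A(1) x(1) i] t
    by (auto intro: has_vector_derivative_transform[rotated 2])
qed

lemma has_vec_derivative_mult_const_mat:
  fixes A :: "'a :: real_normed_field mat"
  assumes "t \<in> S" "A \<in> carrier_mat n k" "\<And>s. s \<in> S \<Longrightarrow> x s \<in> carrier_vec k" "x' \<in> carrier_vec k"
    and "has_vec_derivative x x' (at t within S)"
  shows "has_vec_derivative (\<lambda>s. A *\<^sub>v x s) (A *\<^sub>v x') (at t within S)"
proof -
  have "has_vec_derivative (\<lambda>s. A *\<^sub>v x s) (0\<^sub>m n k *\<^sub>v x t + A *\<^sub>v x') (at t within S)"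
    by (rule has_vec_derivative_mult_mat_vec) (use assms in auto)
  moreover have "0\<^sub>m n k *\<^sub>v x t + A *\<^sub>v x' = A *\<^sub>v x'"
    using assms by (intro eq_vecI) auto
  ultimately show ?thesis by simp
qed

text \<open>A connected set with more than one point has no isolated points. This is what makes
  derivatives relative to \<open>S\<close> unique: at an isolated point every vector would be a
  derivative.\<close>

lemma interval_at_within_neq_bot:
  fixes S :: "real set"
  assumes "is_interval S" "t0 \<in> S" "S \<noteq> {t0}" "t \<in> S"
  shows "at t within S \<noteq> bot"
proof -
  have "t islimpt S"
    using assms by (intro connected_imp_perfect) (auto simp: is_interval_connected_1)
  then show ?thesis by (simp add: trivial_limit_within)
qed

lemma has_vec_derivative_unique:
  assumes "at t within S \<noteq> bot" "d \<in> carrier_vec n" "e \<in> carrier_vec n"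
    and "has_vec_derivative f d (at t within S)" "has_vec_derivative f e (at t within S)"
  shows "d = e"
  using assms unfolding has_vec_derivative_def
  by (intro eq_vecI) (auto intro: vector_derivative_unique_within)

lemma has_vec_derivative_vec_deriv:
  assumes "vec_differentiable_on f S" "t \<in> S"
  shows "has_vec_derivative f (vec_deriv S f t) (at t within S)"
  using assms
  by (auto simp: has_vec_derivative_def vec_deriv_def vec_differentiable_on_def vector_derivative_works)

lemma vec_deriv_eq:
  assumes "has_vec_derivative f d (at t within S)" "at t within S \<noteq> bot" "dim_vec d = dim_vec (f t)"
  shows "vec_deriv S f t = d"
  using assms
  by (intro eq_vecI) (auto simp: has_vec_derivative_def vec_deriv_def intro!: vector_derivative_within)

lemma vec_differentiable_onI:
  assumes "\<And>t. t \<in> S \<Longrightarrow> has_vec_derivative f (f' t) (at t within S)"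
    and "\<And>t. t \<in> S \<Longrightarrow> dim_vec (f' t) = dim_vec (f t)"
  shows "vec_differentiable_on f S"
  using assms unfolding vec_differentiable_on_def has_vec_derivative_def
  by (metis differentiableI_vector)

lemma has_vec_derivative_zero_const:
  assumes "is_interval S" "s \<in> S" "t \<in> S" "\<And>u. u \<in> S \<Longrightarrow> f u \<in> carrier_vec n"
    and "\<And>u. u \<in> S \<Longrightarrow> has_vec_derivative f (0\<^sub>v n) (at u within S)"
  shows "f s = f t"
proof (rule eq_vecI)
  fix i assume "i < dim_vec (f t)"
  then have i: "i < n" using assms(3,4) by force
  show "f s $ i = f t $ i"
  proof (rule has_derivative_zero_unique[of S])
    show "convex S" using assms by (simp add: is_interval_convex_1)
    show "((\<lambda>u. f u $ i) has_derivative (\<lambda>_. 0)) (at u within S)" if "u \<in> S" for u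
      using assms(5)[OF that] i unfolding has_vec_derivative_def has_vector_derivative_def by simp
  qed (use assms in auto)
qed (use assms in \<open>auto dest!: carrier_vecD\<close>)

subsection \<open>The matrix exponential\<close>

text \<open>The recursion of \<open>^\<^sub>m\<close> puts the new factor on the right. Both forms
  are used, to multiply the exponential series by the matrix from either side.\<close>

lemma pow_mat_Suc_left:
  fixes A :: "'a :: semiring_1 mat"
  assumes "A \<in> carrier_mat n n"
  shows "A ^\<^sub>m Suc k = A * A ^\<^sub>m k"
proof (induction k)
  case (Suc k)
  have "A ^\<^sub>m Suc (Suc k) = (A * A ^\<^sub>m k) * A" using Suc by simp
  also have "\<dots> = A * (A ^\<^sub>m k * A)" using assms by (intro assoc_mult_mat) auto
  finally show ?case by simp
qed (use assms in simp)

lemma pow_smult_mat: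
  fixes A :: "'a :: comm_ring_1 mat"
  assumes "A \<in> carrier_mat n n"
  shows "(c \<cdot>\<^sub>m A) ^\<^sub>m k = c ^ k \<cdot>\<^sub>m A ^\<^sub>m k"
proof (induction k)
  case (Suc k)
  have "(c \<cdot>\<^sub>m A) ^\<^sub>m Suc k = (c ^ k \<cdot>\<^sub>m A ^\<^sub>m k) * (c \<cdot>\<^sub>m A)" using Suc by simp
  also have "\<dots> = c ^ Suc k \<cdot>\<^sub>m (A ^\<^sub>m k * A)"
    using assms by (intro eq_matI) (auto simp: ac_simps)
  finally show ?case by simp
qed (use assms in auto)

lemma index_mult_mat_sum:
  "A \<in> carrier_mat n k \<Longrightarrow> B \<in> carrier_mat k l \<Longrightarrow> i < n \<Longrightarrow> j < l \<Longrightarrow>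
   (A * B) $$ (i, j) = (\<Sum>h<k. A $$ (i, h) * B $$ (h, j))"
  by (auto simp: scalar_prod_def lessThan_atLeast0)

lemma pow_mat_norm_bound:
  fixes A :: "'a :: real_normed_field mat"
  assumes A: "A \<in> carrier_mat n n"
  obtains C where "\<And>i j k. i < n \<Longrightarrow> j < n \<Longrightarrow> norm ((A ^\<^sub>m k) $$ (i, j)) \<le> C ^ k"
proof
  \<comment> \<open>The sum of the norms of all entries bounds each of them. An entry of the next
    power is a sum of \<open>n\<close> products, each at most \<open>(of_nat n * M) ^ k * M\<close>,
    whence the witness \<open>of_nat n * M\<close>.\<close>
  define M where "M = (\<Sum>i<n. \<Sum>j<n. norm (A $$ (i, j)))"
  have M0: "M \<ge> 0" unfolding M_def by (intro sum_nonneg) auto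
  have M: "norm (A $$ (i, j)) \<le> M" if "i < n" "j < n" for i j
  proof -
    have "norm (A $$ (i, j)) \<le> (\<Sum>j<n. norm (A $$ (i, j)))"
      using that by (intro member_le_sum) auto
    also have "\<dots> \<le> M" unfolding M_def
      by (rule member_le_sum[of i _ "\<lambda>i. \<Sum>j<n. norm (A $$ (i, j))"]) (use that in \<open>auto intro: sum_nonneg\<close>)
    finally show ?thesis .
  qed
  show "norm ((A ^\<^sub>m k) $$ (i, j)) \<le> (of_nat n * M) ^ k" if "i < n" "j < n" for i j k
    using that(2)
  proof (induction k arbitrary: j)
    case 0
    then show ?case using A that by simp
  next
    case (Suc k)
    have "norm ((A ^\<^sub>m Suc k) $$ (i, j)) = norm (\<Sum>h<n. (A ^\<^sub>m k) $$ (i, h) * A $$ (h, j))"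
      using index_mult_mat_sum[of "A ^\<^sub>m k" n n A n i j] A that Suc.prems by simp
    also have "\<dots> \<le> (\<Sum>h<n. (of_nat n * M) ^ k * M)"
      by (rule sum_norm_le) (use Suc M M0 in \<open>auto simp: norm_mult intro!: mult_mono\<close>)
    also have "\<dots> = (of_nat n * M) ^ Suc k" by simp
    finally show ?case .
  qed
qed

text \<open>Comparison with the exponential series of \<open>C * norm x\<close>. The terms are
  arranged as a power series in a scalar \<open>x\<close>, to which termwise differentiation applies
  later.\<close>

lemma summable_mat_exp:
  fixes A :: "'a :: {real_normed_field, banach} mat"
  assumes A: "A \<in> carrier_mat n n" and ij: "i < n" "j < n"
  shows "summable (\<lambda>k. ((A ^\<^sub>m k) $$ (i, j) /\<^sub>R fact k) * x ^ k)"
proof -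
  obtain C where C: "\<And>i j k. i < n \<Longrightarrow> j < n \<Longrightarrow> norm ((A ^\<^sub>m k) $$ (i, j)) \<le> C ^ k"
    using pow_mat_norm_bound[OF A] by blast
  show ?thesis
  proof (rule summable_comparison_test')
    show "summable (\<lambda>k. (C * norm x) ^ k /\<^sub>R fact k)" by (rule summable_exp_generic)
    show "norm (((A ^\<^sub>m k) $$ (i, j) /\<^sub>R fact k) * x ^ k) \<le> (C * norm x) ^ k /\<^sub>R fact k" for k
      using mult_right_mono[OF C[OF ij, of k], of "norm x ^ k"]
      by (simp add: norm_mult norm_power power_mult_distrib field_simps divide_right_mono)
  qed
qed

lemma dim_mat_exp [simp]: "dim_row (mat_exp A) = dim_row A" "dim_col (mat_exp A) = dim_col A"
  by (simp_all add: mat_exp_def)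

lemma mat_exp_carrier [simp]: "A \<in> carrier_mat n n \<Longrightarrow> mat_exp A \<in> carrier_mat n n"
  by (simp add: mat_exp_def)

lemma mat_exp_smult_index:
  fixes A :: "'a :: {real_normed_field, banach} mat"
  assumes A: "A \<in> carrier_mat n n" and ij: "i < n" "j < n"
  shows "mat_exp (x \<cdot>\<^sub>m A) $$ (i, j) = (\<Sum>k. ((A ^\<^sub>m k) $$ (i, j) /\<^sub>R fact k) * x ^ k)"
  using assms by (simp add: mat_exp_def pow_smult_mat mult.commute)

lemma mat_exp_zero:
  fixes A :: "'a :: {real_normed_field, banach} mat"
  assumes A: "A \<in> carrier_mat n n"
  shows "mat_exp (0 \<cdot>\<^sub>m A) = 1\<^sub>m n"
proof (rule eq_matI)
  fix i j assume "i < dim_row (1\<^sub>m n :: 'a mat)" "j < dim_col (1\<^sub>m n :: 'a mat)"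
  then have ij: "i < n" "j < n" by auto
  show "mat_exp (0 \<cdot>\<^sub>m A) $$ (i, j) = 1\<^sub>m n $$ (i, j)"
    using A ij powser_zero[of "\<lambda>k. (A ^\<^sub>m k) $$ (i, j) /\<^sub>R fact k"]
    by (simp add: mat_exp_smult_index[OF A ij] del: mult_scaleR_left)
qed (use A in \<open>auto simp: mat_exp_def\<close>)

text \<open>The series on the right is also the termwise derivative in \<open>x\<close> of the
  series for entry \<open>(i, j)\<close> of the exponential; through it the derivative is recognised
  as a matrix product.\<close>

lemma mat_exp_mult_left:
  fixes A :: "'a :: {real_normed_field, banach} mat"
  assumes A: "A \<in> carrier_mat n n" and ij: "i < n" "j < n"
  shows "(A * mat_exp (x \<cdot>\<^sub>m A)) $$ (i, j) = (\<Sum>k. ((A ^\<^sub>m Suc k) $$ (i, j) /\<^sub>R fact k) * x ^ k)"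
proof -
  have "(A * mat_exp (x \<cdot>\<^sub>m A)) $$ (i, j) =
      (\<Sum>h<n. \<Sum>k. A $$ (i, h) * (((A ^\<^sub>m k) $$ (h, j) /\<^sub>R fact k) * x ^ k))"
    using A ij index_mult_mat_sum[OF A mat_exp_carrier[of "x \<cdot>\<^sub>m A"], of i j]
    by (simp add: mat_exp_smult_index suminf_mult[OF summable_mat_exp[OF A]] del: mult_scaleR_left mult_scaleR_right)
  also have "\<dots> = (\<Sum>k. \<Sum>h<n. A $$ (i, h) * (((A ^\<^sub>m k) $$ (h, j) /\<^sub>R fact k) * x ^ k))"
    using A ij by (intro suminf_sum[symmetric] summable_mult summable_mat_exp) auto
  also have "\<dots> = (\<Sum>k. ((A ^\<^sub>m Suc k) $$ (i, j) /\<^sub>R fact k) * x ^ k)"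
    using index_mult_mat_sum[OF A pow_carrier_mat[OF A] ij] A ij
    by (simp only: pow_mat_Suc_left[OF A]) (simp add: scaleR_sum_right sum_distrib_right mult.assoc)
  finally show ?thesis .
qed

lemma mat_exp_mult_right:
  fixes A :: "'a :: {real_normed_field, banach} mat"
  assumes A: "A \<in> carrier_mat n n" and ij: "i < n" "j < n"
  shows "(mat_exp (x \<cdot>\<^sub>m A) * A) $$ (i, j) = (\<Sum>k. ((A ^\<^sub>m Suc k) $$ (i, j) /\<^sub>R fact k) * x ^ k)"
proof -
  have "(mat_exp (x \<cdot>\<^sub>m A) * A) $$ (i, j) =
      (\<Sum>h<n. \<Sum>k. A $$ (h, j) * (((A ^\<^sub>m k) $$ (i, h) /\<^sub>R fact k) * x ^ k))"
    using A ij index_mult_mat_sum[OF mat_exp_carrier[of "x \<cdot>\<^sub>m A"] A, of i j]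
    by (simp add: mat_exp_smult_index suminf_mult[OF summable_mat_exp[OF A]] mult.commute[of _ "A $$ (_, j)"] del: mult_scaleR_left mult_scaleR_right)
  also have "\<dots> = (\<Sum>k. \<Sum>h<n. A $$ (h, j) * (((A ^\<^sub>m k) $$ (i, h) /\<^sub>R fact k) * x ^ k))"
    using A ij by (intro suminf_sum[symmetric] summable_mult summable_mat_exp) auto
  also have "\<dots> = (\<Sum>k. ((A ^\<^sub>m Suc k) $$ (i, j) /\<^sub>R fact k) * x ^ k)"
    using index_mult_mat_sum[OF pow_carrier_mat[OF A] A ij] A ij
    by (simp add: scaleR_sum_right sum_distrib_right sum_distrib_left ac_simps)
  finally show ?thesis .
qed

text \<open>Multiplying by \<open>A\<close> from either side raises every power in the series by
  one, so both products have the same entrywise series.\<close>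

lemma mat_exp_commute:
  fixes A :: "'a :: {real_normed_field, banach} mat"
  assumes "A \<in> carrier_mat n n"
  shows "mat_exp (x \<cdot>\<^sub>m A) * A = A * mat_exp (x \<cdot>\<^sub>m A)"
  using assms mat_exp_mult_left[OF assms] mat_exp_mult_right[OF assms]
  by (intro eq_matI) (auto simp: mat_exp_def)

text \<open>The series is differentiated in the scalar field \<open>'a\<close>; the derivative in
  real time is obtained by restricting along \<open>of_real\<close>.\<close>

lemma mat_exp_has_vector_derivative:
  fixes A :: "'a :: {real_normed_field, banach} mat"
  assumes A: "A \<in> carrier_mat n n" and ij: "i < n" "j < n"
  shows "((\<lambda>t. mat_exp (of_real t \<cdot>\<^sub>m A) $$ (i, j)) has_vector_derivative
           (A * mat_exp (of_real t \<cdot>\<^sub>m A)) $$ (i, j)) (at t within S)"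
proof -
  define c where "c = (\<lambda>k. (A ^\<^sub>m k) $$ (i, j) /\<^sub>R fact k)"
  \<comment> \<open>\<open>diffs\<close> multiplies the coefficient of index \<open>k + 1\<close> by
    \<open>k + 1\<close>, which cancels against \<open>fact (k + 1)\<close> and leaves
    \<open>fact k\<close>.\<close>
  have "diffs c k = (A ^\<^sub>m Suc k) $$ (i, j) /\<^sub>R fact k" for k
    by (simp add: diffs_def c_def scaleR_conv_of_real field_simps del: of_nat_Suc pow_mat.simps)
  then have "((\<lambda>x. mat_exp (x \<cdot>\<^sub>m A) $$ (i, j)) has_field_derivative (A * mat_exp (x \<cdot>\<^sub>m A)) $$ (i, j)) (at x)" for x
    using termdiffs_strong_converges_everywhere[of c x] summable_mat_exp[OF A ij]
    unfolding mat_exp_mult_left[OF A ij] by (simp add: mat_exp_smult_index[OF A ij] c_def)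
  then show ?thesis by (rule has_vector_derivative_real_field)
qed

lemma smult_mat_mult_vec:
  fixes A :: "'a :: comm_semiring_0 mat"
  assumes "A \<in> carrier_mat n k" "x \<in> carrier_vec k"
  shows "(c \<cdot>\<^sub>m A) *\<^sub>v x = c \<cdot>\<^sub>v (A *\<^sub>v x)"
  using assms by (intro eq_vecI) (auto simp: scalar_prod_def sum_distrib_left mult.assoc)

text \<open>Chain and product rule in one. A general inner function \<open>g\<close> serves both
  time arguments that run backwards (\<open>t - s\<close>, with \<open>g' = -1\<close>) and those
  that run forwards (\<open>s - a\<close>, with \<open>g' = 1\<close>).\<close>

lemma has_vec_derivative_mat_exp_mult:
  fixes A :: "'a :: {real_normed_field, banach} mat"
  assumes A: "A \<in> carrier_mat n n" and t: "t \<in> S"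
    and x: "\<And>s. s \<in> S \<Longrightarrow> x s \<in> carrier_vec n" "x' \<in> carrier_vec n"
    and dx: "has_vec_derivative x x' (at t within S)"
    and dg: "(g has_vector_derivative g') (at t within S)"
  shows "has_vec_derivative (\<lambda>s. mat_exp (of_real (g s) \<cdot>\<^sub>m A) *\<^sub>v x s)
    (mat_exp (of_real (g t) \<cdot>\<^sub>m A) *\<^sub>v (of_real g' \<cdot>\<^sub>v (A *\<^sub>v x t) + x')) (at t within S)"
proof -
  let ?E = "\<lambda>s. mat_exp (of_real s \<cdot>\<^sub>m A)"
  have E: "?E s \<in> carrier_mat n n" for s using A by simp
  have "has_vec_derivative (\<lambda>s. ?E (g s) *\<^sub>v x s)
    ((of_real g' \<cdot>\<^sub>m (A * ?E (g t))) *\<^sub>v x t + ?E (g t) *\<^sub>v x') (at t within S)"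
  proof (rule has_vec_derivative_mult_mat_vec[OF t _ _ x _ dx])
    fix i j assume ij: "i < n" "j < n"
    have "((\<lambda>s. ?E s $$ (i, j)) \<circ> g has_vector_derivative g' *\<^sub>R (A * ?E (g t)) $$ (i, j)) (at t within S)"
      by (rule vector_diff_chain_within[OF dg mat_exp_has_vector_derivative[OF A ij]])
    then show "((\<lambda>s. ?E (g s) $$ (i, j)) has_vector_derivative
        (of_real g' \<cdot>\<^sub>m (A * ?E (g t))) $$ (i, j)) (at t within S)"
      using A E[of "g t"] ij by (simp add: o_def scaleR_conv_of_real del: index_mult_mat(1))
  qed (use A E in auto)
  \<comment> \<open>Commutation moves the exponential to the left of \<open>A\<close>, so that both
    terms of the product rule share it as a common left factor.\<close>
  moreover have "(of_real g' \<cdot>\<^sub>m (A * ?E (g t))) *\<^sub>v x t = ?E (g t) *\<^sub>v (of_real g' \<cdot>\<^sub>v (A *\<^sub>v x t))"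
  proof -
    have "(of_real g' \<cdot>\<^sub>m (A * ?E (g t))) *\<^sub>v x t = of_real g' \<cdot>\<^sub>v ((?E (g t) * A) *\<^sub>v x t)"
      using smult_mat_mult_vec[OF mult_carrier_mat[OF A E] x(1)[OF t]] by (simp only: mat_exp_commute[OF A])
    also have "\<dots> = of_real g' \<cdot>\<^sub>v (?E (g t) *\<^sub>v (A *\<^sub>v x t))"
      using assoc_mult_mat_vec[OF E A x(1)[OF t]] by simp
    finally show ?thesis
      using A E[of "g t"] x t mult_mat_vec[OF E[of "g t"]] by simp
  qed
  ultimately show ?thesis
    using A E[of "g t"] x t
    by (subst mult_add_distrib_mat_vec[where nr = n and nc = n]) auto
qed

lemma mat_exp_zero_mult_vec:
  fixes A :: "'a :: {real_normed_field, banach} mat"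
  assumes "A \<in> carrier_mat n n" "x \<in> carrier_vec n"
  shows "mat_exp (of_real 0 \<cdot>\<^sub>m A) *\<^sub>v x = x"
  using assms by (simp add: mat_exp_zero)

text \<open>Uniqueness holds because \<open>exp ((t - s) A) x(s)\<close> is constant in \<open>s\<close>.\<close>
lemma linear_ode_solution_eq_mat_exp:
  fixes A :: "'a :: {real_normed_field, banach} mat"
  assumes A: "A \<in> carrier_mat n n" and S: "is_interval S" "t0 \<in> S" "t \<in> S"
    and x: "\<And>s. s \<in> S \<Longrightarrow> x s \<in> carrier_vec n"
    and dx: "\<And>s. s \<in> S \<Longrightarrow> has_vec_derivative x (A *\<^sub>v x s) (at s within S)"
  shows "x t = mat_exp (of_real (t - t0) \<cdot>\<^sub>m A) *\<^sub>v x t0"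
proof -
  let ?f = "\<lambda>s. mat_exp (of_real (t - s) \<cdot>\<^sub>m A) *\<^sub>v x s"
  have "?f t0 = ?f t"
  proof (rule has_vec_derivative_zero_const[OF S])
    fix u assume u: "u \<in> S"
    have "has_vec_derivative ?f (mat_exp (of_real (t - u) \<cdot>\<^sub>m A) *\<^sub>v
        (of_real (- 1) \<cdot>\<^sub>v (A *\<^sub>v x u) + A *\<^sub>v x u)) (at u within S)"
      using A u x dx by (intro has_vec_derivative_mat_exp_mult) (auto intro!: derivative_eq_intros)
    moreover have "of_real (- 1) \<cdot>\<^sub>v (A *\<^sub>v x u) + A *\<^sub>v x u = 0\<^sub>v n"
      using A by (intro eq_vecI) auto
    moreover have "mat_exp (of_real (t - u) \<cdot>\<^sub>m A) *\<^sub>v 0\<^sub>v n = 0\<^sub>v n"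
      using mat_exp_carrier[of "of_real (t - u) \<cdot>\<^sub>m A" n] A by (intro eq_vecI) auto
    ultimately show "has_vec_derivative ?f (0\<^sub>v n) (at u within S)" by simp
    show "?f u \<in> carrier_vec n" using A u x by (intro mult_mat_vec_carrier[of _ _ n]) auto
  qed
  then show ?thesis using mat_exp_zero_mult_vec[OF A x[OF S(3)]] by simp
qed

lemma mat_exp_mult_vec_solves:
  fixes A :: "'a :: {real_normed_field, banach} mat"
  assumes A: "A \<in> carrier_mat n n" and x: "x \<in> carrier_vec n" and t: "t \<in> S"
  shows "has_vec_derivative (\<lambda>s. mat_exp (of_real (s - a) \<cdot>\<^sub>m A) *\<^sub>v x)
    (A *\<^sub>v (mat_exp (of_real (t - a) \<cdot>\<^sub>m A) *\<^sub>v x)) (at t within S)"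
proof -
  let ?E = "mat_exp (of_real (t - a) \<cdot>\<^sub>m A)"
  have E: "?E \<in> carrier_mat n n" using A by simp
  have "has_vec_derivative (\<lambda>s. mat_exp (of_real (s - a) \<cdot>\<^sub>m A) *\<^sub>v x)
      (?E *\<^sub>v (of_real 1 \<cdot>\<^sub>v (A *\<^sub>v x) + 0\<^sub>v n)) (at t within S)"
    using A x t by (intro has_vec_derivative_mat_exp_mult has_vec_derivative_const)
      (auto intro!: derivative_eq_intros)
  moreover have "of_real 1 \<cdot>\<^sub>v (A *\<^sub>v x) + 0\<^sub>v n = A *\<^sub>v x"
    using A by (intro eq_vecI) auto
  moreover have "?E *\<^sub>v (A *\<^sub>v x) = A *\<^sub>v (?E *\<^sub>v x)"
    using assoc_mult_mat_vec[OF E A x] assoc_mult_mat_vec[OF A E x] mat_exp_commute[OF A] by metis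
  ultimately show ?thesis by metis
qed

text \<open>The functional equation follows from uniqueness, without multiplying series:
  \<open>exp (s A) x\<close> solves the homogeneous equation on the whole line with value
  \<open>exp (b A) x\<close> at time \<open>b\<close>, so its value at \<open>a + b\<close> arises
  by propagating this vector for the time \<open>a\<close>.\<close>

lemma mat_exp_add_mult_vec:
  fixes A :: "'a :: {real_normed_field, banach} mat"
  assumes A: "A \<in> carrier_mat n n" and x: "x \<in> carrier_vec n"
  shows "mat_exp (of_real (a + b) \<cdot>\<^sub>m A) *\<^sub>v x =
    mat_exp (of_real a \<cdot>\<^sub>m A) *\<^sub>v (mat_exp (of_real b \<cdot>\<^sub>m A) *\<^sub>v x)"
proof -
  let ?E = "\<lambda>s. mat_exp (of_real s \<cdot>\<^sub>m A)"
  have "?E s *\<^sub>v x \<in> carrier_vec n" for s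
    using A x by (intro mult_mat_vec_carrier[of _ n n]) auto
  moreover have "has_vec_derivative (\<lambda>s. ?E s *\<^sub>v x) (A *\<^sub>v (?E s *\<^sub>v x)) (at s within UNIV)" for s
    using mat_exp_mult_vec_solves[OF A x UNIV_I, of 0 s] by simp
  ultimately have "?E (a + b) *\<^sub>v x = ?E (a + b - b) *\<^sub>v (?E b *\<^sub>v x)"
    by (intro linear_ode_solution_eq_mat_exp[OF A, of UNIV]) auto
  then show ?thesis by simp
qed

subsection \<open>Variation of constants\<close>

text \<open>Both claims are proved in one induction, since additivity of the integral at each step
  presupposes integrability of the partial sum.\<close>

lemma interval_lebesgue_integral_sum:
  fixes f :: "'i \<Rightarrow> real \<Rightarrow> 'b :: {banach, second_countable_topology}"
  assumes "finite I" "\<And>i. i \<in> I \<Longrightarrow> interval_lebesgue_integrable lborel a b (f i)"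
  shows "interval_lebesgue_integrable lborel a b (\<lambda>x. \<Sum>i\<in>I. f i x)"
    and "(LBINT x=a..b. (\<Sum>i\<in>I. f i x)) = (\<Sum>i\<in>I. LBINT x=a..b. f i x)"
proof -
  have "interval_lebesgue_integrable lborel a b (\<lambda>x. \<Sum>i\<in>I. f i x) \<and>
      (LBINT x=a..b. (\<Sum>i\<in>I. f i x)) = (\<Sum>i\<in>I. LBINT x=a..b. f i x)"
    using assms
  proof (induction I)
    case empty
    then show ?case by (simp add: interval_lebesgue_integrable_def set_integrable_def)
  qed auto
  then show "interval_lebesgue_integrable lborel a b (\<lambda>x. \<Sum>i\<in>I. f i x)"
    "(LBINT x=a..b. (\<Sum>i\<in>I. f i x)) = (\<Sum>i\<in>I. LBINT x=a..b. f i x)" by auto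
qed

text \<open>The compact interval between the endpoints lies in \<open>S\<close>. The endpoints may
  come in either order because the integral is oriented.\<close>

lemma interval_integrable_on_interval:
  fixes g :: "real \<Rightarrow> 'b :: {banach, second_countable_topology}"
  assumes "is_interval S" "a \<in> S" "b \<in> S" "continuous_on S g"
  shows "interval_lebesgue_integrable lborel (ereal a) (ereal b) g"
proof -
  have "min a b \<in> S" "max a b \<in> S" using assms by (auto simp: min_def max_def)
  then have sub: "{min a b..max a b} \<subseteq> S"
    using assms(1) unfolding is_interval_1 by (meson atLeastAtMost_iff subsetI)
  have *: "interval_lebesgue_integrable lborel (ereal (min a b)) (ereal (max a b)) g"
    using sub assms(4) by (intro interval_integrable_continuous_on) (auto intro: continuous_on_subset)
  show ?thesis
  proof (cases "a \<le> b")
    case False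
    then show ?thesis
      using * by (subst interval_integrable_endpoints_reverse) (simp add: min_def max_def)
  qed (use * in simp)
qed

text \<open>For an interval \<open>S\<close> that may be open or unbounded, the fundamental theorem
  is applied on a compact \<open>{a..b}\<close> inside \<open>S\<close> that contains
  \<open>t0\<close> and \<open>t\<close> and is a neighbourhood of \<open>t\<close> relative to
  \<open>S\<close>.\<close>

lemma interval_integral_FTC_interval:
  fixes g :: "real \<Rightarrow> 'b :: euclidean_space"
  assumes S: "is_interval S" "t0 \<in> S" "t \<in> S" and g: "continuous_on S g"
  shows "((\<lambda>u. LBINT s=ereal t0..ereal u. g s) has_vector_derivative g t) (at t within S)"
proof -
  \<comment> \<open>\<open>b\<close> lies strictly to the right of \<open>t\<close> unless
    \<open>t\<close> is the greatest element of \<open>S\<close>; \<open>a\<close> is chosen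
    symmetrically.\<close>
  obtain b where b: "b \<in> S" "t0 \<le> b" "t \<le> b" "t = b \<Longrightarrow> \<forall>y\<in>S. y \<le> t"
  proof (cases "\<exists>y\<in>S. t < y")
    case True
    then obtain y where "y \<in> S" "t < y" by blast
    then show ?thesis using S by (intro that[of "max y t0"]) (auto simp: max_def)
  qed (use S that[of t] in force)
  obtain a where a: "a \<in> S" "a \<le> t0" "a \<le> t" "t = a \<Longrightarrow> \<forall>y\<in>S. t \<le> y"
  proof (cases "\<exists>y\<in>S. y < t")
    case True
    then obtain y where "y \<in> S" "y < t" by blast
    then show ?thesis using S by (intro that[of "min y t0"]) (auto simp: min_def)
  qed (use S that[of t] in force)
  have sub: "{a..b} \<subseteq> S"
    using S(1) a(1) b(1) unfolding is_interval_1 by (meson atLeastAtMost_iff subsetI)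
  \<comment> \<open>An open neighbourhood of \<open>t\<close> in which \<open>S\<close> and
    \<open>{a..b}\<close> coincide. If \<open>a = t\<close> or \<open>b = t\<close>, then
    \<open>S\<close> has no points beyond \<open>t\<close> on that side, and the distance 1 is
    arbitrary.\<close>
  let ?U = "{if a < t then a else t - 1<..<if t < b then b else t + 1}"
  have "at t within S = at t within {a..b}"
  proof (rule at_within_nhd)
    show "t \<in> ?U" by auto
    show "S \<inter> ?U - {t} = {a..b} \<inter> ?U - {t}"
    proof -
      have "a \<le> x \<and> x \<le> b" if "x \<in> S" "x \<in> ?U" for x
        using that a b by (cases "a < t"; cases "t < b") auto
      then show ?thesis using sub by fastforce
    qed
  qed auto
  then show ?thesis
    using interval_integral_FTC2[of a t0 b g t] a b continuous_on_subset[OF g sub] by simp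
qed

lemma continuous_on_mat_exp_mult_vec:
  fixes A :: "'a :: {real_normed_field, banach} mat"
  assumes A: "A \<in> carrier_mat n n" and g: "continuous_on S g"
    and b: "\<And>s. s \<in> S \<Longrightarrow> b s \<in> carrier_vec n"
    and cb: "\<And>i. i < n \<Longrightarrow> continuous_on S (\<lambda>s. b s $ i)" and i: "i < n"
  shows "continuous_on S (\<lambda>s. (mat_exp (of_real (g s) \<cdot>\<^sub>m A) *\<^sub>v b s) $ i)"
proof -
  have E: "continuous_on UNIV (\<lambda>s. mat_exp (of_real s \<cdot>\<^sub>m A) $$ (i, j))" if "j < n" for j
    using mat_exp_has_vector_derivative[OF A i that] by (rule continuous_on_vector_derivative)
  have "continuous_on S (\<lambda>s. \<Sum>j<n. mat_exp (of_real (g s) \<cdot>\<^sub>m A) $$ (i, j) * b s $ j)"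
    using g cb by (intro continuous_intros continuous_on_compose2[OF E g]) auto
  then show ?thesis
    using A b i by (subst continuous_on_cong[OF refl index_mult_mat_vec_sum[where n = n and k = n]]) auto
qed

text \<open>The variable \<open>t\<close> occurs both as a limit of integration and in the
  integrand. The functional equation factors it out of the integrand: \<open>x u\<close> is
  \<open>exp ((u - t0) A)\<close> applied to \<open>c u\<close>, where \<open>c\<close> integrates a
  function independent of \<open>u\<close>. The product rule and the fundamental theorem then give
  the derivative.\<close>

lemma variation_of_constants:
  fixes A :: "'a :: {real_normed_field, euclidean_space} mat"
  assumes A: "A \<in> carrier_mat n n" and S: "is_interval S" "t0 \<in> S"
    and b: "\<And>s. s \<in> S \<Longrightarrow> b s \<in> carrier_vec n"
    and cb: "\<And>i. i < n \<Longrightarrow> continuous_on S (\<lambda>s. b s $ i)" and t: "t \<in> S"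
  defines "x \<equiv> \<lambda>t. vec_interval_integral n t0 t (\<lambda>s. mat_exp (of_real (t - s) \<cdot>\<^sub>m A) *\<^sub>v b s)"
  shows "has_vec_derivative x (A *\<^sub>v x t + b t) (at t within S)"
proof -
  let ?E = "\<lambda>s. mat_exp (of_real s \<cdot>\<^sub>m A)"
  have E: "?E s \<in> carrier_mat n n" for s using A by simp
  define c where "c = (\<lambda>t. vec_interval_integral n t0 t (\<lambda>s. ?E (t0 - s) *\<^sub>v b s))"
  have c: "c s \<in> carrier_vec n" for s by (simp add: c_def vec_interval_integral_def)
  have cont: "continuous_on S (\<lambda>s. (?E (t0 - s) *\<^sub>v b s) $ i)" if "i < n" for i
    using that b cb A by (intro continuous_on_mat_exp_mult_vec continuous_intros) auto
  have xc: "x u = ?E (u - t0) *\<^sub>v c u" if u: "u \<in> S" for u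
  proof (rule eq_vecI)
    fix i assume "i < dim_vec (?E (u - t0) *\<^sub>v c u)"
    then have i: "i < n" using A by simp
    have sum: "(?E (u - s) *\<^sub>v b s) $ i = (\<Sum>j<n. ?E (u - t0) $$ (i, j) * (?E (t0 - s) *\<^sub>v b s) $ j)"
      if "s \<in> S" for s
    proof -
      have "u - t0 + (t0 - s) = u - s" by simp
      then show ?thesis
        using mat_exp_add_mult_vec[OF A b[OF that], of "u - t0" "t0 - s"]
          index_mult_mat_vec_sum[OF E mult_mat_vec_carrier[OF E b[OF that]] i, of "u - t0" "t0 - s"]
        by metis
    qed
    have sub: "s \<in> S" if "s \<in> einterval (min (ereal t0) (ereal u)) (max (ereal t0) (ereal u))" for s
    proof -
      have "min t0 u \<in> S" "max t0 u \<in> S" using S u by (auto simp: min_def max_def)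
      moreover have "min t0 u \<le> s" "s \<le> max t0 u"
        using that by (auto simp: einterval_def min_def max_def split: if_splits)
      ultimately show ?thesis using S(1) unfolding is_interval_1 by blast
    qed
    have "x u $ i = (LBINT s=ereal t0..ereal u. (?E (u - s) *\<^sub>v b s) $ i)"
      using i by (simp add: x_def vec_interval_integral_def del: index_mult_mat_vec)
    also have "\<dots> =
        (LBINT s=ereal t0..ereal u. (\<Sum>j<n. ?E (u - t0) $$ (i, j) * (?E (t0 - s) *\<^sub>v b s) $ j))"
      by (intro interval_integral_cong sum sub)
    also have "\<dots> = (\<Sum>j<n. LBINT s=ereal t0..ereal u. ?E (u - t0) $$ (i, j) * (?E (t0 - s) *\<^sub>v b s) $ j)"
      using cont S u
      by (intro interval_lebesgue_integral_sum interval_integrable_on_interval[of S] continuous_intros) auto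
    also have "\<dots> = (?E (u - t0) *\<^sub>v c u) $ i"
      unfolding index_mult_mat_vec_sum[OF E c i]
      by (simp del: index_mult_mat_vec add: c_def vec_interval_integral_def)
    finally show "x u $ i = (?E (u - t0) *\<^sub>v c u) $ i" .
  qed (use A in \<open>simp add: x_def vec_interval_integral_def\<close>)
  have "has_vec_derivative c (?E (t0 - t) *\<^sub>v b t) (at t within S)"
    unfolding has_vec_derivative_def
  proof safe
    fix i assume "i < dim_vec (?E (t0 - t) *\<^sub>v b t)"
    then have "i < n" using A by simp
    then show "((\<lambda>s. c s $ i) has_vector_derivative (?E (t0 - t) *\<^sub>v b t) $ i) (at t within S)"
      using interval_integral_FTC_interval[OF S t cont]
      by (simp del: index_mult_mat_vec add: c_def vec_interval_integral_def)
  qed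
  then have "has_vec_derivative (\<lambda>u. ?E (u - t0) *\<^sub>v c u)
      (?E (t - t0) *\<^sub>v (of_real 1 \<cdot>\<^sub>v (A *\<^sub>v c t) + ?E (t0 - t) *\<^sub>v b t)) (at t within S)"
    using A t c b[OF t] mult_mat_vec_carrier[OF E b[OF t], of "t0 - t"]
    by (intro has_vec_derivative_mat_exp_mult) (auto intro!: derivative_eq_intros)
  moreover have "?E (t - t0) *\<^sub>v (of_real 1 \<cdot>\<^sub>v (A *\<^sub>v c t) + ?E (t0 - t) *\<^sub>v b t) = A *\<^sub>v x t + b t"
  proof -
    have "?E (t - t0) *\<^sub>v (of_real 1 \<cdot>\<^sub>v (A *\<^sub>v c t) + ?E (t0 - t) *\<^sub>v b t) =
        ?E (t - t0) *\<^sub>v (A *\<^sub>v c t) + ?E (t - t0) *\<^sub>v (?E (t0 - t) *\<^sub>v b t)"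
      using mult_add_distrib_mat_vec[OF E mult_mat_vec_carrier[OF A c] mult_mat_vec_carrier[OF E b[OF t]]]
      by (simp del: of_real_diff)
    \<comment> \<open>The two times add up to 0, so the exponentials cancel and the bare
      inhomogeneity remains.\<close>
    also have "?E (t - t0) *\<^sub>v (?E (t0 - t) *\<^sub>v b t) = b t"
      using mat_exp_add_mult_vec[OF A b[OF t], of "t - t0" "t0 - t"] mat_exp_zero_mult_vec[OF A b[OF t]]
      by simp
    also have "?E (t - t0) *\<^sub>v (A *\<^sub>v c t) = (A * ?E (t - t0)) *\<^sub>v c t"
      using assoc_mult_mat_vec[OF E A c] mat_exp_commute[OF A] by metis
    also have "\<dots> = A *\<^sub>v x t"
      unfolding xc[OF t] by (rule assoc_mult_mat_vec[OF A E c])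
    finally show ?thesis .
  qed
  ultimately have "has_vec_derivative (\<lambda>u. ?E (u - t0) *\<^sub>v c u) (A *\<^sub>v x t + b t) (at t within S)"
    by simp
  then show ?thesis by (rule has_vec_derivative_transform) (use t xc in auto)
qed

subsection \<open>The nilpotent part\<close>

text \<open>The induction lowers the exponent \<open>k - j\<close> from \<open>k\<close> to 0. Each
  step concludes from the vanishing of a function on \<open>S\<close> that its derivative vanishes,
  which rests on uniqueness of derivatives and hence on the hypothesis about
  \<open>at t within S\<close>.\<close>

lemma nilpotent_dae_zero:
  fixes H :: "'a :: real_normed_field mat"
  assumes H: "H \<in> carrier_mat n n" "H ^\<^sub>m k = 0\<^sub>m n n"
    and w: "\<And>t. t \<in> S \<Longrightarrow> w t \<in> carrier_vec n" "\<And>t. t \<in> S \<Longrightarrow> w' t \<in> carrier_vec n"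
    and dw: "\<And>t. t \<in> S \<Longrightarrow> has_vec_derivative w (w' t) (at t within S)"
    and bot: "\<And>t. t \<in> S \<Longrightarrow> at t within S \<noteq> bot"
    and eq: "\<And>t. t \<in> S \<Longrightarrow> H *\<^sub>v w' t = w t"
    and t: "t \<in> S"
  shows "w t = 0\<^sub>v n"
proof -
  have "j \<le> k \<Longrightarrow> \<forall>t\<in>S. (H ^\<^sub>m (k - j)) *\<^sub>v w t = 0\<^sub>v n" for j
  proof (induction j)
    case 0
    then show ?case using H w by (auto intro!: eq_vecI)
  next
    case (Suc j)
    define l where "l = k - Suc j"
    have l: "k - j = Suc l" using Suc.prems by (simp add: l_def)
    show ?case
    proof
      fix u assume u: "u \<in> S"
      have d1: "has_vec_derivative (\<lambda>s. (H ^\<^sub>m Suc l) *\<^sub>v w s) ((H ^\<^sub>m Suc l) *\<^sub>v w' u) (at u within S)"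
        using H w dw u by (intro has_vec_derivative_mult_const_mat[of _ _ _ n n]) auto
      have d2: "has_vec_derivative (\<lambda>s. (H ^\<^sub>m Suc l) *\<^sub>v w s) (0\<^sub>v n) (at u within S)"
        using Suc u unfolding l
        by (intro has_vec_derivative_transform[OF has_vec_derivative_const[of "0\<^sub>v n"]]) auto
      have "(H ^\<^sub>m Suc l) *\<^sub>v w' u = 0\<^sub>v n"
        by (rule has_vec_derivative_unique[OF bot[OF u] mult_mat_vec_carrier[OF pow_carrier_mat[OF H(1)] w(2)[OF u]]
              zero_carrier_vec d1 d2])
      \<comment> \<open>One factor \<open>H\<close> is absorbed by the equation
        \<open>H w' = w\<close>, trading the derivative for a lower power.\<close>
      moreover have "(H ^\<^sub>m Suc l) *\<^sub>v w' u = (H ^\<^sub>m l) *\<^sub>v w u"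
        using H w u eq by (simp add: assoc_mult_mat_vec[of _ n n _ n])
      ultimately show "(H ^\<^sub>m (k - Suc j)) *\<^sub>v w u = 0\<^sub>v n" by (simp add: l_def)
    qed
  qed
  from this[of k] show ?thesis using H w t by auto
qed

text \<open>With \<open>D\<close> for differentiation, the equation reads
  \<open>(H D - 1) z = u 0\<close>, and \<open>z\<close> is minus the Neumann series of
  \<open>1 - H D\<close> applied to \<open>u 0\<close>, cut off where \<open>H\<close> vanishes. The
  functions \<open>u i\<close> stand for the successive derivatives of \<open>u 0\<close>, of which
  \<open>z\<close> involves those below \<open>k\<close> and \<open>z'\<close> those up to
  \<open>k\<close>.\<close>

lemma nilpotent_dae_particular:
  fixes H :: "'a :: real_normed_field mat"
  assumes H: "H \<in> carrier_mat n n" "H ^\<^sub>m k = 0\<^sub>m n n"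
    and u: "\<And>i t. t \<in> S \<Longrightarrow> u i t \<in> carrier_vec n"
    and du: "\<And>i t. i < k \<Longrightarrow> t \<in> S \<Longrightarrow> has_vec_derivative (u i) (u (Suc i) t) (at t within S)"
    and t: "t \<in> S"
  defines "z \<equiv> \<lambda>t. vec n (\<lambda>j. - (\<Sum>i<k. ((H ^\<^sub>m i) *\<^sub>v u i t) $ j))"
    and "z' \<equiv> \<lambda>t. vec n (\<lambda>j. - (\<Sum>i<k. ((H ^\<^sub>m i) *\<^sub>v u (Suc i) t) $ j))"
  shows "has_vec_derivative z (z' t) (at t within S)"
    and "H *\<^sub>v z' t = z t + u 0 t"
proof -
  show "has_vec_derivative z (z' t) (at t within S)"
    unfolding has_vec_derivative_def
  proof safe
    fix j assume "j < dim_vec (z' t)"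
    then have j: "j < n" by (simp add: z'_def)
    have "((\<lambda>s. ((H ^\<^sub>m i) *\<^sub>v u i s) $ j) has_vector_derivative ((H ^\<^sub>m i) *\<^sub>v u (Suc i) t) $ j) (at t within S)"
      if "i < k" for i
    proof -
      have "has_vec_derivative (\<lambda>s. (H ^\<^sub>m i) *\<^sub>v u i s) ((H ^\<^sub>m i) *\<^sub>v u (Suc i) t) (at t within S)"
        using H u t du that by (intro has_vec_derivative_mult_const_mat[of _ _ _ n n]) auto
      then show ?thesis using j H by (simp add: has_vec_derivative_def del: index_mult_mat_vec)
    qed
    then show "((\<lambda>s. z s $ j) has_vector_derivative z' t $ j) (at t within S)"
      using j by (simp add: z_def z'_def del: index_mult_mat_vec)
        (intro has_vector_derivative_minus has_vector_derivative_sum, simp del: index_mult_mat_vec)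
  qed
  show "H *\<^sub>v z' t = z t + u 0 t"
  proof (rule eq_vecI)
    fix j assume "j < dim_vec (z t + u 0 t)"
    then have j: "j < n" using u[OF t, of 0] by simp
    let ?s = "\<lambda>i. ((H ^\<^sub>m i) *\<^sub>v u i t) $ j"
    have Suc: "?s (Suc i) = (\<Sum>l<n. H $$ (j, l) * ((H ^\<^sub>m i) *\<^sub>v u (Suc i) t) $ l)" for i
      using index_mult_mat_vec_sum[OF H(1) mult_mat_vec_carrier[OF pow_carrier_mat[OF H(1)] u[OF t]] j]
        assoc_mult_mat_vec[OF H(1) pow_carrier_mat[OF H(1)] u[OF t]] pow_mat_Suc_left[OF H(1)]
      by metis
    have "(H *\<^sub>v z' t) $ j = (\<Sum>l<n. H $$ (j, l) * z' t $ l)"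
      using H j by (intro index_mult_mat_vec_sum) (auto simp: z'_def)
    also have "\<dots> = - (\<Sum>l<n. \<Sum>i<k. H $$ (j, l) * ((H ^\<^sub>m i) *\<^sub>v u (Suc i) t) $ l)"
      by (simp add: z'_def sum_distrib_left sum_negf del: index_mult_mat_vec)
    also have "\<dots> = - (\<Sum>i<k. ?s (Suc i))"
      unfolding Suc by (subst sum.swap) simp
    \<comment> \<open>After the index shift the sum runs up to \<open>k\<close>; its last term
      vanishes because \<open>H ^\<^sub>m k = 0\<close>, and the term \<open>?s 0\<close> is the
      inhomogeneity.\<close>
    also have "\<dots> = ?s 0 - (\<Sum>i<Suc k. ?s i)"
      unfolding sum.lessThan_Suc_shift by simp
    also have "\<dots> = (z t + u 0 t) $ j"
      using H j u[OF t] by (simp add: z_def del: index_mult_mat_vec) (simp add: carrier_vecD[OF u[OF t]])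
    finally show "(H *\<^sub>v z' t) $ j = (z t + u 0 t) $ j" .
  qed (use H u[OF t, of 0] in \<open>simp add: z_def\<close>)
qed

subsection \<open>The Weierstrass block form\<close>

lemma invertible_mat_obtain:
  fixes A :: "'a :: semiring_1 mat"
  assumes "A \<in> carrier_mat n n" "invertible_mat A"
  obtains B where "B \<in> carrier_mat n n" "A * B = 1\<^sub>m n" "B * A = 1\<^sub>m n"
proof -
  obtain B where B: "A * B = 1\<^sub>m n" "B * A = 1\<^sub>m (dim_row B)"
    using assms by (auto simp: invertible_mat_def inverts_mat_def)
  \<comment> \<open>The definition of invertibility leaves the size of \<open>B\<close> open; it is
    read off from the two identities.\<close>
  have "dim_col (A * B) = n" "dim_col (B * A) = dim_row B" unfolding B by simp_all
  then have "B \<in> carrier_mat n n" using assms(1) by auto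
  then show thesis using that B by auto
qed

text \<open>\<open>mat_inverse\<close> returns an option. Invertibility places \<open>A\<close>
  among the units of the matrix ring, which excludes \<open>None\<close>.\<close>

lemma mat_inverse_invertible:
  fixes A :: "'a :: field mat"
  assumes A: "A \<in> carrier_mat n n" "invertible_mat A"
  defines "B \<equiv> the (mat_inverse A)"
  shows "B \<in> carrier_mat n n" "A * B = 1\<^sub>m n" "B * A = 1\<^sub>m n"
proof -
  obtain C where "C \<in> carrier_mat n n" "A * C = 1\<^sub>m n" "C * A = 1\<^sub>m n"
    using invertible_mat_obtain[OF A] .
  then have "A \<in> Units (ring_mat TYPE('a) n ())"
    using A by (auto simp: Units_def ring_mat_def)
  then have "mat_inverse A \<noteq> None" using mat_inverse(1)[OF A(1), of "()"] by blast
  then obtain D where "mat_inverse A = Some D" by blast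
  then show "B \<in> carrier_mat n n" "A * B = 1\<^sub>m n" "B * A = 1\<^sub>m n"
    using mat_inverse(2)[OF A(1)] by (auto simp: B_def)
qed

lemma mult_mat_vec_inj:
  fixes A :: "'a :: comm_semiring_1 mat"
  assumes "A \<in> carrier_mat n n" "B \<in> carrier_mat n n" "B * A = 1\<^sub>m n"
    and "x \<in> carrier_vec n" "y \<in> carrier_vec n"
  shows "A *\<^sub>v x = A *\<^sub>v y \<longleftrightarrow> x = y"
  using assms assoc_mult_mat_vec[of B n n A n x] assoc_mult_mat_vec[of B n n A n y]
  by (metis one_mult_mat_vec)

text \<open>Powers act blockwise, and the \<open>k\<close>-th power of a nilpotent block moves the
  superdiagonal of ones to distance \<open>k\<close> from the diagonal, which is outside a block of
  size at most \<open>k\<close>.\<close>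

lemma jordan_matrix_zero_pow:
  assumes "\<And>n. n \<in> set ns \<Longrightarrow> n \<le> k"
  shows "jordan_matrix (map (\<lambda>n. (n, 0 :: 'a :: field)) ns) ^\<^sub>m k = 0\<^sub>m (sum_list ns) (sum_list ns)"
  unfolding jordan_matrix_pow using assms
proof (induction ns)
  case (Cons n ns)
  have "jordan_block n (0 :: 'a) ^\<^sub>m k = 0\<^sub>m n n"
    unfolding jordan_block_zero_pow using Cons.prems[of n] by (intro eq_matI) auto
  then show ?case
    using Cons by (auto simp: Let_def intro!: eq_matI)
qed simp

text \<open>\<open>block_cols\<close> is a four-block matrix whose lower blocks have no rows, so the
  second component of the product has length 0.\<close>

lemma mult_mat_vec_block_cols:
  fixes A :: "'a :: comm_ring_1 mat"
  assumes "A \<in> carrier_mat m p" "B \<in> carrier_mat m q" "x \<in> carrier_vec p" "y \<in> carrier_vec q"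
  shows "block_cols A B *\<^sub>v (x @\<^sub>v y) = A *\<^sub>v x + B *\<^sub>v y"
proof -
  have "block_cols A B *\<^sub>v (x @\<^sub>v y) =
      (A *\<^sub>v x + B *\<^sub>v y) @\<^sub>v (0\<^sub>m 0 p *\<^sub>v x + 0\<^sub>m 0 q *\<^sub>v y)"
    using assms unfolding block_cols_def by (auto intro!: four_block_mat_mult_vec)
  then show ?thesis by (auto intro!: eq_vecI)
qed

lemma diag_block_mat_pair:
  "diag_block_mat [A, B] = four_block_mat A (0\<^sub>m (dim_row A) (dim_col B)) (0\<^sub>m (dim_row B) (dim_col A)) B"
  by (simp only: diag_block_mat.simps(2)[of A "[B]"] diag_block_mat_singleton Let_def)

lemma weierstrass_form_dims:
  assumes "F \<in> carrier_mat m m" "P \<in> carrier_mat m m" "Q \<in> carrier_mat m m" "weierstrass_form F G P Q as qs"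
  shows "m = sum_list (map fst as) + sum_list qs"
proof -
  have "dim_row (P * F * Q) = sum_list (map fst as) + sum_list qs"
    using assms(4) by (simp add: weierstrass_form_def dim_diag_block_mat o_def)
  then show ?thesis using assms by simp
qed

text \<open>Without nilpotent blocks \<open>P * F * Q\<close> is the identity, and
  \<open>Q * P\<close> inverts \<open>F\<close>. Singularity of \<open>F\<close> thus guarantees
  that the maximal block size is taken over a nonempty set.\<close>

lemma weierstrass_singular:
  assumes "F \<in> carrier_mat m m" "P \<in> carrier_mat m m" "Q \<in> carrier_mat m m"
    and W: "weierstrass_form F G P Q as qs" and "\<not> invertible_mat F"
  shows "qs \<noteq> []"
proof
  assume qs: "qs = []"
  note F = assms(1) and P = assms(2) and Q = assms(3)
  have m: "m = sum_list (map fst as)" using weierstrass_form_dims[OF F P Q W] qs by simp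
  have PFQ: "P * F * Q = 1\<^sub>m m"
    using W qs by (auto simp: weierstrass_form_def m jordan_matrix_def intro!: eq_matI)
  obtain P' where P': "P' \<in> carrier_mat m m" "P' * P = 1\<^sub>m m"
    using invertible_mat_obtain[OF P] W by (auto simp: weierstrass_form_def)
  obtain Q' where Q': "Q' \<in> carrier_mat m m" "Q * Q' = 1\<^sub>m m"
    using invertible_mat_obtain[OF Q] W by (auto simp: weierstrass_form_def)
  have "F * Q = P' * P * (F * Q)" using P' F Q by simp
  also have "\<dots> = P' * (P * F * Q)"
    using P'(1) P F Q by (simp add: assoc_mult_mat[of _ m m _ m _ m])
  finally have FQ: "F * Q = P'" using PFQ P' by simp
  have "P * F = P * F * (Q * Q')" using Q' F P by simp
  also have "\<dots> = P * F * Q * Q'"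
    using Q'(1) P F Q by (simp add: assoc_mult_mat[of _ m m _ m _ m])
  finally have PF: "P * F = Q'" using PFQ Q' by simp
  have "F * (Q * P) = 1\<^sub>m m"
    using assoc_mult_mat[OF F Q P] FQ P' by simp
  moreover have "Q * P * F = 1\<^sub>m m"
    using assoc_mult_mat[OF Q P F] PF Q' by simp
  ultimately have "invertible_mat F"
    using F Q P by (auto simp: invertible_mat_def inverts_mat_def intro!: exI[of _ "Q * P"])
  with assms(5) show False by simp
qed

text \<open>The algebra at a single instant: \<open>x'\<close> and \<open>y'\<close> are arbitrary
  vectors here, later to be derivatives. Left multiplication by the invertible \<open>P\<close>
  gives an equivalent equation, which the block forms split into its two components.\<close>

lemma weierstrass_dae_iff:
  fixes F :: "'a :: field mat"
  assumes F: "F \<in> carrier_mat m m" and G: "G \<in> carrier_mat m m" and B: "B \<in> carrier_mat m r"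
    and P: "P \<in> carrier_mat m m" and Q: "Q \<in> carrier_mat m m"
    and W: "weierstrass_form F G P Q as qs"
    and p: "p = sum_list (map fst as)" and q: "q = sum_list qs"
    and Bp: "Bp \<in> carrier_mat p r" and Bq: "Bq \<in> carrier_mat q r" and PB: "P * B = Bp @\<^sub>r Bq"
    and v: "v \<in> carrier_vec r"
    and x: "x \<in> carrier_vec p" "x' \<in> carrier_vec p" and y: "y \<in> carrier_vec q" "y' \<in> carrier_vec q"
  shows "F *\<^sub>v (Q *\<^sub>v (x' @\<^sub>v y')) = G *\<^sub>v (Q *\<^sub>v (x @\<^sub>v y)) + B *\<^sub>v v \<longleftrightarrow>
    x' = jordan_matrix as *\<^sub>v x + Bp *\<^sub>v v \<and> jordan_matrix (map (\<lambda>n. (n, 0)) qs) *\<^sub>v y' = y + Bq *\<^sub>v v"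
proof -
  let ?J = "jordan_matrix as" and ?H = "jordan_matrix (map (\<lambda>n. (n, 0 :: 'a)) qs)"
  have J: "?J \<in> carrier_mat p p" unfolding p by (rule jordan_matrix_carrier)
  have H: "?H \<in> carrier_mat q q"
    using jordan_matrix_carrier[of "map (\<lambda>n. (n, 0 :: 'a)) qs"] by (simp add: q o_def)
  have m: "m = p + q" using weierstrass_form_dims[OF F P Q W] p q by simp
  have xy: "x @\<^sub>v y \<in> carrier_vec m" "x' @\<^sub>v y' \<in> carrier_vec m" using x y m by auto
  obtain P' where P': "P' \<in> carrier_mat m m" "P' * P = 1\<^sub>m m"
    using invertible_mat_obtain[OF P] W by (auto simp: weierstrass_form_def)
  have assoc: "P *\<^sub>v (M *\<^sub>v (Q *\<^sub>v z)) = (P * M * Q) *\<^sub>v z" if "M \<in> carrier_mat m m" "z \<in> carrier_vec m" for M z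
    using that P Q by (simp add: assoc_mult_mat_vec[of _ m m _ m])
  have PFQ: "P * F * Q = four_block_mat (1\<^sub>m p) (0\<^sub>m p q) (0\<^sub>m q p) ?H"
    and PGQ: "P * G * Q = four_block_mat ?J (0\<^sub>m p q) (0\<^sub>m q p) (1\<^sub>m q)"
    using W carrier_matD[OF J] carrier_matD[OF H]
    by (simp_all only: weierstrass_form_def diag_block_mat_pair p[symmetric] q[symmetric] index_one_mat)
  have L: "P *\<^sub>v (F *\<^sub>v (Q *\<^sub>v (x' @\<^sub>v y'))) = x' @\<^sub>v (?H *\<^sub>v y')"
    unfolding assoc[OF F xy(2)] PFQ using mult_mat_vec_split[OF one_carrier_mat H x(2) y(2)] x by simp
  have "P *\<^sub>v (G *\<^sub>v (Q *\<^sub>v (x @\<^sub>v y)) + B *\<^sub>v v) =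
      P *\<^sub>v (G *\<^sub>v (Q *\<^sub>v (x @\<^sub>v y))) + P *\<^sub>v (B *\<^sub>v v)"
    using P G Q B v xy by (intro mult_add_distrib_mat_vec) auto
  also have "P *\<^sub>v (G *\<^sub>v (Q *\<^sub>v (x @\<^sub>v y))) = (?J *\<^sub>v x) @\<^sub>v y"
    unfolding assoc[OF G xy(1)] PGQ using mult_mat_vec_split[OF J one_carrier_mat x(1) y(1)] y by simp
  also have "P *\<^sub>v (B *\<^sub>v v) = (Bp *\<^sub>v v) @\<^sub>v (Bq *\<^sub>v v)"
    using assoc_mult_mat_vec[OF P B v] PB mat_mult_append[OF Bp Bq v] by simp
  also have "((?J *\<^sub>v x) @\<^sub>v y) + ((Bp *\<^sub>v v) @\<^sub>v (Bq *\<^sub>v v)) = (?J *\<^sub>v x + Bp *\<^sub>v v) @\<^sub>v (y + Bq *\<^sub>v v)"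
    using J x y Bp Bq v by (intro append_vec_add[of _ p _ _ q]) auto
  finally have R: "P *\<^sub>v (G *\<^sub>v (Q *\<^sub>v (x @\<^sub>v y)) + B *\<^sub>v v) = \<dots>" .
  have "F *\<^sub>v (Q *\<^sub>v (x' @\<^sub>v y')) = G *\<^sub>v (Q *\<^sub>v (x @\<^sub>v y)) + B *\<^sub>v v \<longleftrightarrow>
      P *\<^sub>v (F *\<^sub>v (Q *\<^sub>v (x' @\<^sub>v y'))) = P *\<^sub>v (G *\<^sub>v (Q *\<^sub>v (x @\<^sub>v y)) + B *\<^sub>v v)"
    using F G Q B v xy by (intro mult_mat_vec_inj[OF P P', symmetric]) auto
  also have "\<dots> \<longleftrightarrow> x' = ?J *\<^sub>v x + Bp *\<^sub>v v \<and> ?H *\<^sub>v y' = y + Bq *\<^sub>v v"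
    unfolding L R using x J Bp v by (intro append_vec_eq[of _ p]) auto
  finally show ?thesis .
qed

section \<open>Column spans, iterated derivatives and the decoupled system\<close>

lemma column_span_eq:
  assumes "A \<in> carrier_mat m p"
  shows "column_span A = {A *\<^sub>v x | x. x \<in> carrier_vec p}"
  using vec_space.col_space_eq[OF assms] assms by auto

lemma vec_derivs_Suc: "vec_derivs S (Suc k) f = vec_deriv S (vec_derivs S k f)"
  by (simp add: vec_derivs_def)

lemma dim_vec_deriv [simp]: "dim_vec (vec_deriv S f t) = dim_vec (f t)"
  by (simp only: vec_deriv_def dim_vec)

lemma dim_vec_derivs: "dim_vec (vec_derivs S k f t) = dim_vec (f t)"
  by (induction k) (simp_all add: vec_derivs_Suc, simp add: vec_derivs_def)

lemma vec_derivs_carrier: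
  assumes "\<And>t. t \<in> S \<Longrightarrow> f t \<in> carrier_vec n" "t \<in> S"
  shows "vec_derivs S k f t \<in> carrier_vec n"
  using carrier_vecD[OF assms(1)[OF assms(2)]] by (intro carrier_vecI) (simp only: dim_vec_derivs)

lemma has_vec_derivative_vec_derivs:
  assumes "vec_times_differentiable_on k f S" "i < k" "t \<in> S"
  shows "has_vec_derivative (vec_derivs S i f) (vec_derivs S (Suc i) f t) (at t within S)"
  unfolding vec_derivs_Suc
  by (rule has_vec_derivative_vec_deriv) (use assms in \<open>simp_all add: vec_times_differentiable_on_def\<close>)

lemma vec_diff_add_cancel:
  fixes a b :: "'a :: group_add vec"
  assumes "a \<in> carrier_vec n" "b \<in> carrier_vec n"
  shows "a - b + b = a"
  using assms by (intro eq_vecI) auto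

text \<open>Serves in both directions: to verify the candidate solution and to take an arbitrary
  solution apart. Uniqueness of derivatives identifies \<open>vec_deriv S Y\<close> with the image
  under \<open>Q\<close> of the given derivatives \<open>x'\<close> and \<open>y'\<close>.\<close>

lemma dae_solution_iff_blocks:
  fixes F :: "'a :: {real_normed_field, euclidean_space} mat"
  assumes F: "F \<in> carrier_mat m m" and G: "G \<in> carrier_mat m m" and B: "B \<in> carrier_mat m r"
    and P: "P \<in> carrier_mat m m" and Q: "Q \<in> carrier_mat m m"
    and W: "weierstrass_form F G P Q as qs"
    and p: "p = sum_list (map fst as)" and q: "q = sum_list qs"
    and Bp: "Bp \<in> carrier_mat p r" and Bq: "Bq \<in> carrier_mat q r" and PB: "P * B = Bp @\<^sub>r Bq"
    and bot: "\<And>t. t \<in> S \<Longrightarrow> at t within S \<noteq> bot"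
    and V: "\<And>t. t \<in> S \<Longrightarrow> V t \<in> carrier_vec r"
    and x: "\<And>t. t \<in> S \<Longrightarrow> x t \<in> carrier_vec p" "\<And>t. t \<in> S \<Longrightarrow> x' t \<in> carrier_vec p"
    and y: "\<And>t. t \<in> S \<Longrightarrow> y t \<in> carrier_vec q" "\<And>t. t \<in> S \<Longrightarrow> y' t \<in> carrier_vec q"
    and dx: "\<And>t. t \<in> S \<Longrightarrow> has_vec_derivative x (x' t) (at t within S)"
    and dy: "\<And>t. t \<in> S \<Longrightarrow> has_vec_derivative y (y' t) (at t within S)"
    and Y: "\<And>t. t \<in> S \<Longrightarrow> Y t = Q *\<^sub>v (x t @\<^sub>v y t)"
  shows "dae_solution F G B V S Y \<longleftrightarrow> (\<forall>t\<in>S.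
    x' t = jordan_matrix as *\<^sub>v x t + Bp *\<^sub>v V t \<and>
    jordan_matrix (map (\<lambda>n. (n, 0)) qs) *\<^sub>v y' t = y t + Bq *\<^sub>v V t)"
proof -
  have m: "m = p + q" using weierstrass_form_dims[OF F P Q W] p q by simp
  have xy: "x t @\<^sub>v y t \<in> carrier_vec m" "x' t @\<^sub>v y' t \<in> carrier_vec m" if "t \<in> S" for t
    using x[OF that] y[OF that] m by auto
  have dY: "has_vec_derivative Y (Q *\<^sub>v (x' t @\<^sub>v y' t)) (at t within S)" if t: "t \<in> S" for t
  proof (rule has_vec_derivative_transform[OF _ t Y])
    have "has_vec_derivative (\<lambda>t. x t @\<^sub>v y t) (x' t @\<^sub>v y' t) (at t within S)"
      by (rule has_vec_derivative_append[OF dx[OF t] dy[OF t] t x(1) y(1) x(2)[OF t] y(2)[OF t]])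
    then show "has_vec_derivative (\<lambda>t. Q *\<^sub>v (x t @\<^sub>v y t)) (Q *\<^sub>v (x' t @\<^sub>v y' t)) (at t within S)"
      using xy t by (intro has_vec_derivative_mult_const_mat[OF t Q]) auto
  qed
  have dim: "dim_vec (Q *\<^sub>v (x' t @\<^sub>v y' t)) = dim_vec (Y t)" if "t \<in> S" for t
    using Y[OF that] by simp
  have "vec_differentiable_on Y S" by (rule vec_differentiable_onI[OF dY dim])
  moreover have "Y t \<in> carrier_vec (dim_col F)" if "t \<in> S" for t
    using Y[OF that] F Q xy[OF that] by simp
  moreover have "vec_deriv S Y t = Q *\<^sub>v (x' t @\<^sub>v y' t)" if "t \<in> S" for t
    by (rule vec_deriv_eq[OF dY[OF that] bot[OF that] dim[OF that]])
  ultimately show ?thesis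
    unfolding dae_solution_def
    by (simp add: Y weierstrass_dae_iff[OF F G B P Q W p q Bp Bq PB] V x y)
qed

text \<open>Solutions with the same initial value always agree on \<open>T\<close>, so the
  membership condition in effect decides existence.\<close>

theorem theorem2p1:
  fixes F G B P Q Qp Qq Bp Bq Jp Hq :: "'a :: {real_normed_field, euclidean_space} mat"
    and as :: "(nat \<times> 'a) list" and qs :: "nat list"
    and m r p q qmax :: nat
    and T :: "real set" and t0 :: real
    and V :: "real \<Rightarrow> 'a vec" and Y0 Z0 :: "'a vec" and K :: "real \<Rightarrow> 'a vec"
  assumes F: "F \<in> carrier_mat m m" and G: "G \<in> carrier_mat m m" and B: "B \<in> carrier_mat m r"
    and P: "P \<in> carrier_mat m m" and Q: "Q \<in> carrier_mat m m"
    and F_singular: "\<not> invertible_mat F"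
    and regular: "regular_pencil F G"
    and weierstrass: "weierstrass_form F G P Q as qs"
    and Jp: "Jp = jordan_matrix as" and p: "p = sum_list (map fst as)"
    and Hq: "Hq = jordan_matrix (map (\<lambda>n. (n, 0)) qs)" and q: "q = sum_list qs"
    and qmax: "qmax = Max (set qs)"
    and Qp: "Qp \<in> carrier_mat m p" and Qq: "Qq \<in> carrier_mat m q"
    and Q_split: "Q = block_cols Qp Qq"
    and Bp: "Bp \<in> carrier_mat p r" and Bq: "Bq \<in> carrier_mat q r"
    and B_split: "P * B = Bp @\<^sub>r Bq"
    and T: "is_interval T" "t0 \<in> T" "T \<noteq> {t0}"
    and V: "\<And>t. t \<in> T \<Longrightarrow> V t \<in> carrier_vec r"
    and V_diff: "vec_times_differentiable_on qmax V T"
    and Y0: "Y0 \<in> carrier_vec m"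
    and K: "K = particular_K T t0 Jp Bp Hq Bq qmax V"
    and Z0: "Z0 = the (mat_inverse Q) *\<^sub>v Y0"
  shows "(ivp_has_unique_solution F G B V T t0 Y0 \<longleftrightarrow>
            Y0 \<in> {x + Q *\<^sub>v K t0 | x. x \<in> column_span Qp}) \<and>
         (Y0 \<in> {x + Q *\<^sub>v K t0 | x. x \<in> column_span Qp} \<longrightarrow>
            ivp_solution F G B V T t0 Y0
              (\<lambda>t. Qp *\<^sub>v (mat_exp (of_real (t - t0) \<cdot>\<^sub>m Jp) *\<^sub>v vec_first Z0 p) + Q *\<^sub>v K t)) \<and>
         (\<forall>Y. ivp_solution F G B V T t0 Y0 Y \<longrightarrow>
            (\<forall>t\<in>T. Y t =
              Qp *\<^sub>v (mat_exp (of_real (t - t0) \<cdot>\<^sub>m Jp) *\<^sub>v vec_first Z0 p) + Q *\<^sub>v K t))"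
proof -
  have J: "Jp \<in> carrier_mat p p" unfolding Jp p by (rule jordan_matrix_carrier)
  have H: "Hq \<in> carrier_mat q q"
    using jordan_matrix_carrier[of "map (\<lambda>n. (n, 0 :: 'a)) qs"] by (simp add: Hq q o_def)
  have m: "m = p + q" using weierstrass_form_dims[OF F P Q weierstrass] p q by simp
  have "qs \<noteq> []" by (rule weierstrass_singular[OF F P Q weierstrass F_singular])
  then have "qmax \<in> set qs" unfolding qmax by (intro Max_in) auto
  \<comment> \<open>\<open>V\<close> is therefore differentiable at least once, hence continuous, as
    variation of constants requires.\<close>
  then have qmax_pos: "0 < qmax"
    using weierstrass by (auto simp: weierstrass_form_def intro: gr0I)
  have Hpow: "Hq ^\<^sub>m qmax = 0\<^sub>m q q"
    unfolding Hq q qmax by (rule jordan_matrix_zero_pow) simp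
  have bot: "at t within T \<noteq> bot" if "t \<in> T" for t
    by (rule interval_at_within_neq_bot[OF T that])
  define Qi where "Qi = the (mat_inverse Q)"
  have Qi: "Qi \<in> carrier_mat m m" "Q * Qi = 1\<^sub>m m" "Qi * Q = 1\<^sub>m m"
    using mat_inverse_invertible[OF Q] weierstrass by (auto simp: weierstrass_form_def Qi_def)
  have QQi: "Q *\<^sub>v (Qi *\<^sub>v x) = x" and QiQ: "Qi *\<^sub>v (Q *\<^sub>v x) = x" if "x \<in> carrier_vec m" for x
    using assoc_mult_mat_vec[OF Q Qi(1) that] assoc_mult_mat_vec[OF Qi(1) Q that] Qi that by simp_all
  define z0 where "z0 = vec_first Z0 p"
  have z0: "z0 \<in> carrier_vec p" by (simp add: z0_def)

  \<comment> \<open>The finite block: a particular solution by variation of constants\<close>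
  define b where "b = (\<lambda>t. Bp *\<^sub>v V t)"
  have b: "b t \<in> carrier_vec p" if "t \<in> T" for t using Bp V[OF that] by (simp add: b_def)
  have cb: "continuous_on T (\<lambda>t. b t $ i)" if i: "i < p" for i
  proof (rule continuous_on_vector_derivative)
    fix t assume t: "t \<in> T"
    have "has_vec_derivative V (vec_derivs T (Suc 0) V t) (at t within T)"
      using has_vec_derivative_vec_derivs[OF V_diff qmax_pos t] by (simp add: vec_derivs_def)
    then have "has_vec_derivative b (Bp *\<^sub>v vec_derivs T (Suc 0) V t) (at t within T)"
      unfolding b_def using V vec_derivs_carrier[OF V] t
      by (intro has_vec_derivative_mult_const_mat[OF t Bp]) auto
    then show "((\<lambda>t. b t $ i) has_vector_derivative (Bp *\<^sub>v vec_derivs T (Suc 0) V t) $ i) (at t within T)"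
      using Bp i by (simp add: has_vec_derivative_def del: index_mult_mat_vec)
  qed
  define xp where "xp = (\<lambda>t. vec_interval_integral p t0 t (\<lambda>s. mat_exp (of_real (t - s) \<cdot>\<^sub>m Jp) *\<^sub>v b s))"
  have xp: "xp t \<in> carrier_vec p" for t by (simp add: xp_def vec_interval_integral_def)
  have xp_t0: "xp t0 = 0\<^sub>v p" by (auto simp: xp_def vec_interval_integral_def)
  have dxp: "has_vec_derivative xp (Jp *\<^sub>v xp t + b t) (at t within T)" if "t \<in> T" for t
    unfolding xp_def by (rule variation_of_constants[OF J T(1,2) b cb that])

  \<comment> \<open>The nilpotent block: the solution as a finite sum of derivatives\<close>
  define u where "u = (\<lambda>i t. Bq *\<^sub>v vec_derivs T i V t)"
  have u: "u i t \<in> carrier_vec q" if "t \<in> T" for i t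
    using Bq vec_derivs_carrier[OF V that] by (simp add: u_def)
  have u0: "u 0 t = Bq *\<^sub>v V t" for t by (simp add: u_def vec_derivs_def)
  have du: "has_vec_derivative (u i) (u (Suc i) t) (at t within T)" if "i < qmax" "t \<in> T" for i t
    unfolding u_def using has_vec_derivative_vec_derivs[OF V_diff that] vec_derivs_carrier[OF V] that
    by (intro has_vec_derivative_mult_const_mat[OF that(2) Bq]) auto
  define zq where "zq = (\<lambda>t. vec q (\<lambda>j. - (\<Sum>i<qmax. ((Hq ^\<^sub>m i) *\<^sub>v u i t) $ j)))"
  define zq' where "zq' = (\<lambda>t. vec q (\<lambda>j. - (\<Sum>i<qmax. ((Hq ^\<^sub>m i) *\<^sub>v u (Suc i) t) $ j)))"
  have zq: "zq t \<in> carrier_vec q" "zq' t \<in> carrier_vec q" for t by (simp_all add: zq_def zq'_def)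
  have dzq: "has_vec_derivative zq (zq' t) (at t within T)"
    and zq_eq: "Hq *\<^sub>v zq' t = zq t + Bq *\<^sub>v V t" if "t \<in> T" for t
    using nilpotent_dae_particular[of Hq q qmax T u, OF H Hpow u du that]
    unfolding zq_def zq'_def u0[symmetric] by blast+

  \<comment> \<open>The candidate solution\<close>
  have K_eq: "K t = xp t @\<^sub>v zq t" for t
    using J H by (simp add: K particular_K_def xp_def zq_def b_def u_def)
  define Z where "Z = (\<lambda>t. mat_exp (of_real (t - t0) \<cdot>\<^sub>m Jp) *\<^sub>v z0)"
  have Z: "Z t \<in> carrier_vec p" for t
    unfolding Z_def using J z0 by (intro mult_mat_vec_carrier[of _ p p]) auto
  have dZ: "has_vec_derivative Z (Jp *\<^sub>v Z t) (at t within T)" if "t \<in> T" for t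
    unfolding Z_def by (rule mat_exp_mult_vec_solves[OF J z0 that])
  have Z_t0: "Z t0 = z0" using mat_exp_zero_mult_vec[OF J z0] by (simp add: Z_def)
  define Phi where "Phi = (\<lambda>t. Qp *\<^sub>v Z t + Q *\<^sub>v K t)"
  have Qsplit: "Q *\<^sub>v (x @\<^sub>v y) = Qp *\<^sub>v x + Qq *\<^sub>v y" if "x \<in> carrier_vec p" "y \<in> carrier_vec q" for x y
    unfolding Q_split by (rule mult_mat_vec_block_cols[OF Qp Qq that])
  \<comment> \<open>Adding a vector of the column span of \<open>Qp\<close> changes only the first
    \<open>p\<close> coordinates with respect to \<open>Q\<close>.\<close>
  have shift: "Qp *\<^sub>v z + Q *\<^sub>v K t = Q *\<^sub>v ((z + xp t) @\<^sub>v zq t)" if z: "z \<in> carrier_vec p" for z t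
  proof -
    have "Qp *\<^sub>v z + Q *\<^sub>v K t = Qp *\<^sub>v z + (Qp *\<^sub>v xp t + Qq *\<^sub>v zq t)"
      unfolding K_eq Qsplit[OF xp zq(1)] ..
    also have "\<dots> = Qp *\<^sub>v z + Qp *\<^sub>v xp t + Qq *\<^sub>v zq t"
      using Qp Qq z xp[of t] zq(1)[of t] by (intro assoc_add_vec[symmetric, of _ m]) auto
    also have "\<dots> = Q *\<^sub>v ((z + xp t) @\<^sub>v zq t)"
      unfolding Qsplit[OF add_carrier_vec[OF z xp] zq(1)] mult_add_distrib_mat_vec[OF Qp z xp] ..
    finally show ?thesis .
  qed
  \<comment> \<open>\<open>Phi\<close> solves the differential equation whatever \<open>Y0\<close>
    is; consistency of \<open>Y0\<close> enters only in showing \<open>Phi t0 = Y0\<close>.\<close>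
  have dae: "dae_solution F G B V T Phi"
  proof -
    have "has_vec_derivative (\<lambda>t. Z t + xp t) (Jp *\<^sub>v Z t + (Jp *\<^sub>v xp t + b t)) (at t within T)"
      if t: "t \<in> T" for t
      using J Z xp b[OF t] by (intro has_vec_derivative_add[OF dZ[OF t] dxp[OF t] t, of p]) auto
    moreover have "Jp *\<^sub>v Z t + (Jp *\<^sub>v xp t + b t) = Jp *\<^sub>v (Z t + xp t) + b t" if "t \<in> T" for t
      unfolding mult_add_distrib_mat_vec[OF J Z xp]
      using J Z xp b[OF that] by (intro assoc_add_vec[symmetric, of _ p]) auto
    ultimately have d: "has_vec_derivative (\<lambda>t. Z t + xp t) (Jp *\<^sub>v (Z t + xp t) + b t) (at t within T)"
      if "t \<in> T" for t using that by simp
    show ?thesis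
    proof (subst dae_solution_iff_blocks[OF F G B P Q weierstrass p q Bp Bq B_split bot V _ _ zq d dzq])
      show "Phi t = Q *\<^sub>v ((Z t + xp t) @\<^sub>v zq t)" for t
        unfolding Phi_def by (rule shift[OF Z])
      show "Z t + xp t \<in> carrier_vec p" for t using Z xp by simp
      show "Jp *\<^sub>v (Z t + xp t) + b t \<in> carrier_vec p" if "t \<in> T" for t
        using J Z xp b[OF that] by simp
      show "\<forall>t\<in>T. Jp *\<^sub>v (Z t + xp t) + b t = jordan_matrix as *\<^sub>v (Z t + xp t) + Bp *\<^sub>v V t \<and>
          jordan_matrix (map (\<lambda>n. (n, 0)) qs) *\<^sub>v zq' t = zq t + Bq *\<^sub>v V t"
        using zq_eq by (simp add: Jp Hq b_def)
    qed
  qed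

  \<comment> \<open>Existence for consistent initial values\<close>
  let ?C = "{x + Q *\<^sub>v K t0 | x. x \<in> column_span Qp}"
  have exist: "ivp_solution F G B V T t0 Y0 Phi" if "Y0 \<in> ?C"
  proof -
    obtain z where z: "z \<in> carrier_vec p" "Y0 = Qp *\<^sub>v z + Q *\<^sub>v K t0"
      using \<open>Y0 \<in> ?C\<close> unfolding column_span_eq[OF Qp] by auto
    \<comment> \<open>The integral vanishes at \<open>t0\<close>, so the coordinates of
      \<open>Y0\<close> are \<open>z\<close> followed by \<open>zq t0\<close>. Hence
      \<open>z0\<close>, defined from \<open>Y0\<close>, is the coefficient vector \<open>z\<close>
      of the column span.\<close>
    have "Y0 = Q *\<^sub>v (z @\<^sub>v zq t0)" using z shift[OF z(1), of t0] by (simp add: xp_t0)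
    then have "Z0 = z @\<^sub>v zq t0"
      unfolding Z0 Qi_def[symmetric] using QiQ z zq(1) m by simp
    then have "z0 = z" using z(1) zq(1)[of t0] by (auto simp: z0_def vec_first_def intro!: eq_vecI)
    then show ?thesis using dae z(2) Z_t0 by (simp add: ivp_solution_def Phi_def)
  qed

  \<comment> \<open>Every solution agrees with the candidate\<close>
  have uniq: "Y t = Phi t" if sol: "ivp_solution F G B V T t0 Y0 Y" and t: "t \<in> T" for Y t
  proof -
    have Y: "dae_solution F G B V T Y" "Y t0 = Y0" using sol by (auto simp: ivp_solution_def)
    then have Ym: "Y s \<in> carrier_vec m" if "s \<in> T" for s
      using that F by (auto simp: dae_solution_def)
    have dY: "has_vec_derivative Y (vec_deriv T Y s) (at s within T)" if "s \<in> T" for s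
      using Y(1) that by (intro has_vec_derivative_vec_deriv) (auto simp: dae_solution_def)
    have Y'm: "vec_deriv T Y s \<in> carrier_vec m" if "s \<in> T" for s
      using carrier_vecD[OF Ym[OF that]] by (intro carrier_vecI) (simp only: dim_vec_deriv)
    \<comment> \<open>An arbitrary solution is written in the coordinates given by \<open>Q\<close>,
      where its two parts satisfy separate equations.\<close>
    define w where "w = (\<lambda>s. Qi *\<^sub>v Y s)"
    define w' where "w' = (\<lambda>s. Qi *\<^sub>v vec_deriv T Y s)"
    have w: "w s \<in> carrier_vec (p + q)" "w' s \<in> carrier_vec (p + q)" if "s \<in> T" for s
      using Qi(1) Ym[OF that] Y'm[OF that] m by (auto simp: w_def w'_def)
    have dw: "has_vec_derivative w (w' s) (at s within T)" if "s \<in> T" for s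
      unfolding w_def w'_def
      by (rule has_vec_derivative_mult_const_mat[OF that Qi(1) Ym Y'm[OF that] dY[OF that]])
    define x where "x = (\<lambda>s. vec_first (w s) p)"
    define y where "y = (\<lambda>s. vec_last (w s) q)"
    have xy: "x s \<in> carrier_vec p" "y s \<in> carrier_vec q" for s by (simp_all add: x_def y_def)
    have dx: "has_vec_derivative x (vec_first (w' s) p) (at s within T)"
      and dy: "has_vec_derivative y (vec_last (w' s) q) (at s within T)" if "s \<in> T" for s
      unfolding x_def y_def using dw[OF that] w that
      by (auto intro!: has_vec_derivative_vec_first has_vec_derivative_vec_last[of _ _ _ _ p])
    have Yxy: "Y s = Q *\<^sub>v (x s @\<^sub>v y s)" if "s \<in> T" for s
      using QQi[OF Ym[OF that]] vec_first_last_append[OF w(1)[OF that]] by (simp add: x_def y_def w_def)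
    have sys: "vec_first (w' s) p = Jp *\<^sub>v x s + b s" "Hq *\<^sub>v vec_last (w' s) q = y s + Bq *\<^sub>v V s"
      if "s \<in> T" for s
      using Y(1) that unfolding Jp Hq b_def
      by (subst (asm) dae_solution_iff_blocks[OF F G B P Q weierstrass p q Bp Bq B_split bot V
            xy(1) vec_first_carrier xy(2) vec_last_carrier dx dy Yxy]; simp)+
    \<comment> \<open>The difference of two solutions of the nilpotent block satisfies the
      homogeneous equation and vanishes; no initial value is used.\<close>
    have yzq: "y s = zq s" if s: "s \<in> T" for s
    proof -
      have "y s - zq s = 0\<^sub>v q"
      proof (rule nilpotent_dae_zero[OF H Hpow _ _ _ bot _ s])
        fix s assume s: "s \<in> T"
        show "has_vec_derivative (\<lambda>s. y s - zq s) (vec_last (w' s) q - zq' s) (at s within T)"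
          using zq by (intro has_vec_derivative_diff[OF dy[OF s] dzq[OF s] s, of q]) auto
        have "Hq *\<^sub>v (vec_last (w' s) q - zq' s) = (y s + Bq *\<^sub>v V s) - (zq s + Bq *\<^sub>v V s)"
          unfolding mult_minus_distrib_mat_vec[OF H vec_last_carrier zq(2)] sys(2)[OF s] zq_eq[OF s] ..
        also have "\<dots> = y s - zq s"
          using xy(2)[of s] zq(1)[of s] Bq V[OF s] by (intro eq_vecI) auto
        finally show "Hq *\<^sub>v (vec_last (w' s) q - zq' s) = y s - zq s" .
      qed (use xy zq in auto)
      then show ?thesis
        using vec_diff_add_cancel[OF xy(2) zq(1), of s s] zq(1)[of s] by simp
    qed
    \<comment> \<open>The difference solves the homogeneous linear equation, so it is the
      exponential applied to its value at \<open>t0\<close>, which is \<open>z0\<close> because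
      \<open>xp t0 = 0\<close>.\<close>
    have xxp: "x s - xp s = mat_exp (of_real (s - t0) \<cdot>\<^sub>m Jp) *\<^sub>v (x t0 - xp t0)" if s: "s \<in> T" for s
    proof (rule linear_ode_solution_eq_mat_exp[OF J T(1,2) s])
      fix s assume s: "s \<in> T"
      have "has_vec_derivative (\<lambda>s. x s - xp s) ((Jp *\<^sub>v x s + b s) - (Jp *\<^sub>v xp s + b s)) (at s within T)"
        using J xy xp b[OF s] dx[OF s, unfolded sys(1)[OF s]]
        by (intro has_vec_derivative_diff[OF _ dxp[OF s] s, of _ _ p]) auto
      moreover have "(Jp *\<^sub>v x s + b s) - (Jp *\<^sub>v xp s + b s) = Jp *\<^sub>v (x s - xp s)"
        unfolding mult_minus_distrib_mat_vec[OF J xy(1) xp]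
        using J xy(1)[of s] xp[of s] b[OF s] by (intro eq_vecI) auto
      ultimately show "has_vec_derivative (\<lambda>s. x s - xp s) (Jp *\<^sub>v (x s - xp s)) (at s within T)" by simp
      show "x s - xp s \<in> carrier_vec p" using xy xp by simp
    qed
    have "x t0 - xp t0 = z0"
      using xy(1)[of t0] Y(2) by (auto simp: xp_t0 z0_def Z0 x_def w_def Qi_def)
    then have "x t - xp t = Z t" using xxp[OF t] by (simp add: Z_def)
    then have "x t = Z t + xp t"
      using vec_diff_add_cancel[OF xy(1) xp, of t t] by simp
    then show ?thesis
      unfolding Yxy[OF t] Phi_def using shift[OF Z] yzq[OF t] by simp
  qed
  \<comment> \<open>Evaluating the uniqueness formula at \<open>t0\<close> exhibits
    \<open>Y0\<close> as an element of the translated column span.\<close>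
  have necessary: "Y0 \<in> ?C" if "ivp_solution F G B V T t0 Y0 Y" for Y
  proof -
    have "Y0 = Qp *\<^sub>v z0 + Q *\<^sub>v K t0"
      using uniq[OF that T(2)] that Z_t0 by (simp add: ivp_solution_def Phi_def)
    then show ?thesis unfolding column_span_eq[OF Qp] using z0 by blast
  qed
  have Phi_eq: "(\<lambda>t. Qp *\<^sub>v (mat_exp (of_real (t - t0) \<cdot>\<^sub>m Jp) *\<^sub>v vec_first Z0 p) + Q *\<^sub>v K t) = Phi"
    by (simp add: Phi_def Z_def z0_def)
  have "ivp_has_unique_solution F G B V T t0 Y0 \<longleftrightarrow> Y0 \<in> ?C"
    unfolding ivp_has_unique_solution_def using exist uniq necessary by blast
  moreover have "\<forall>Y. ivp_solution F G B V T t0 Y0 Y \<longrightarrow> (\<forall>t\<in>T. Y t =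
      Qp *\<^sub>v (mat_exp (of_real (t - t0) \<cdot>\<^sub>m Jp) *\<^sub>v vec_first Z0 p) + Q *\<^sub>v K t)"
    using uniq unfolding Phi_eq[symmetric] by blast
  moreover have "Y0 \<in> ?C \<longrightarrow> ivp_solution F G B V T t0 Y0
      (\<lambda>t. Qp *\<^sub>v (mat_exp (of_real (t - t0) \<cdot>\<^sub>m Jp) *\<^sub>v vec_first Z0 p) + Q *\<^sub>v K t)"
    unfolding Phi_eq using exist by (rule impI)
  ultimately show ?thesis by (intro conjI)
qed

end
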